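(* Let $n,t\ge1$ be integers and $\mathbb R[X]:=\mathbb R[X_1,\ldots,X_n]$. Let $\mathcal G\subseteq\mathcal S_t(\mathbb R[X])$ be a finite set of polynomial matrices of even degrees. Let $\mathbf F\in\mathcal S_t(\mathbb R[X])$ be a polynomial matrix of even degree. Denote $\widetilde{\mathcal G}:=\{\widetilde{\mathbf G} : \mathbf G\in\mathcal G\}\subseteq\mathcal S_t(\mathbb R[X_0,X_1,\ldots,X_n])$. If $\widetilde{\mathbf F}(x)>0$ (positive definite) for all $x\in K(\widetilde{\mathcal G})\setminus\{0\}\subseteq\mathbb R^{n+1}$, then there exist a finite set $G$ of polynomials in $\mathbb R[X]$ of even degrees and an integer $N>0$ such that $$\Big(1+\sum_{i=1}^nX_i^2\Big)^N\mathbf F\in M(G)^t\subseteq\mathcal M(\mathcal G).$$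
   Context: $\mathcal M_t(R)$ is the algebra of $t\times t$ matrices over a polynomial ring $R$ ("polynomial matrices"), and $\mathcal S_t(R)$ its subset of symmetric matrices. The degree of a polynomial matrix is the maximum of the degrees of its entries. The homogenization of $\mathbf G=\sum_{|\alpha|\le d}\mathbf G_\alpha X^\alpha\in\mathcal M_t(\mathbb R[X])$ of degree $d$ (with $\mathbf G_\alpha\in\mathcal M_t(\mathbb R)$) is $\widetilde{\mathbf G}(X_0,\ldots,X_n)=\sum_{|\alpha|\le d}\mathbf G_\alpha X^\alpha X_0^{d-|\alpha|}$. For a set $\mathcal H$ of symmetric polynomial matrices in $q$ variables, $K(\mathcal H)=\{x\in\mathbb R^q:\mathbf H(x)\text{ is positive semidefinite for all }\mathbf H\in\mathcal H\}$. $\mathcal M(\mathcal G)$ is the quadratic module generated by $\mathcal G$: the set of all finite sums of matrices $\mathbf A^T\mathbf G\mathbf A$ with $\mathbf G\in\mathcal G\cup\{\mathbf I\}$ and $\mathbf A\in\mathcal M_t(\mathbb R[X])$. For $G\subseteq\mathbb R[X]$, $M(G)$ is the set of all $\sigma_0+\sum_{i=1}^m\sigma_ig_i$ with $m\in\mathbb N$, $g_i\in G$ and $\sigma_i$ finite sums of squares of polynomials in $\mathbb R[X]$. For a quadratic module $M\subseteq\mathbb R[X]$, $M^t$ is the set of all finite sums $\sum_i m_i\mathbf A_i^T\mathbf A_i$ with $m_i\in M$ and $\mathbf A_i\in\mathcal M_t(\mathbb R[X])$. *)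

theory Defs
  imports "HOL-Analysis.Analysis" "HOL-Library.Poly_Mapping"
begin

text \<open>
  For a finite type \<open>'v\<close> of variables, \<open>'v pol\<close> is the polynomial ring over the reals in the
  indeterminates \<open>X i\<close>, \<open>i :: 'v\<close>: finitely supported maps from exponent vectors to coefficients,
  multiplied by convolution. The variables \<open>X\<^sub>1, \<dots>, X\<^sub>n\<close> are indexed by a finite type \<open>'n\<close>, and
  \<open>X\<^sub>0, X\<^sub>1, \<dots>, X\<^sub>n\<close> by \<open>'n option\<close>, with \<open>None\<close> as the index of \<open>X\<^sub>0\<close>.
\<close>

type_synonym 'v pol = "('v \<Rightarrow>\<^sub>0 nat) \<Rightarrow>\<^sub>0 real"

type_synonym ('v, 't) pol_mat = "(('v pol, 't) vec, 't) vec"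

definition X :: "'v \<Rightarrow> 'v pol" where
  "X i = Poly_Mapping.single (Poly_Mapping.single i 1) 1"

definition eval_pol :: "real ^ 'v \<Rightarrow> 'v pol \<Rightarrow> real" where
  "eval_pol x p =
     (\<Sum>\<alpha>\<in>Poly_Mapping.keys p. Poly_Mapping.lookup p \<alpha> * (\<Prod>i\<in>UNIV. x $ i ^ Poly_Mapping.lookup \<alpha> i))"

definition exp_deg :: "('v::finite \<Rightarrow>\<^sub>0 nat) \<Rightarrow> nat" where
  "exp_deg \<alpha> = (\<Sum>i\<in>UNIV. Poly_Mapping.lookup \<alpha> i)"

text \<open>The zero polynomial has degree 0 here, hence even degree.\<close>

definition pol_deg :: "'v::finite pol \<Rightarrow> nat" where
  "pol_deg p = Max (insert 0 (exp_deg ` Poly_Mapping.keys p))"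

definition mat_deg :: "('v::finite, 't::finite) pol_mat \<Rightarrow> nat" where
  "mat_deg A = Max (range (\<lambda>(i, j). pol_deg (A $ i $ j)))"

definition eval_mat :: "real ^ 'v \<Rightarrow> ('v, 't::finite) pol_mat \<Rightarrow> real ^ 't ^ 't" where
  "eval_mat x A = map_matrix (eval_pol x) A"

text \<open>
  \<open>homog_exp d \<alpha>\<close> is the exponent vector of \<open>X\<^bsup>\<alpha>\<^esup> X\<^sub>0\<^bsup>d-|\<alpha>|\<^esup>\<close>. The subtraction truncates, so
  \<open>homog_pol d p\<close> is meaningful only for \<open>d \<ge> pol_deg p\<close>. In \<open>homog_mat\<close> all the entries are
  homogenized to the degree of the matrix, not to their own degrees.
\<close>

definition homog_exp :: "nat \<Rightarrow> ('n::finite \<Rightarrow>\<^sub>0 nat) \<Rightarrow> ('n option \<Rightarrow>\<^sub>0 nat)" where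
  "homog_exp d \<alpha> = Poly_Mapping.single None (d - exp_deg \<alpha>)
     + (\<Sum>i\<in>UNIV. Poly_Mapping.single (Some i) (Poly_Mapping.lookup \<alpha> i))"

definition homog_pol :: "nat \<Rightarrow> 'n::finite pol \<Rightarrow> 'n option pol" where
  "homog_pol d p =
     (\<Sum>\<alpha>\<in>Poly_Mapping.keys p. Poly_Mapping.single (homog_exp d \<alpha>) (Poly_Mapping.lookup p \<alpha>))"

definition homog_mat :: "('n::finite, 't::finite) pol_mat \<Rightarrow> ('n option, 't) pol_mat" where
  "homog_mat A = map_matrix (homog_pol (mat_deg A)) A"

definition sym_mat :: "'a ^ 't ^ 't \<Rightarrow> bool" where
  "sym_mat A \<longleftrightarrow> transpose A = A"

definition psd_mat :: "real ^ 't ^ 't \<Rightarrow> bool" where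
  "psd_mat A \<longleftrightarrow> sym_mat A \<and> (\<forall>v. 0 \<le> v \<bullet> (A *v v))"

definition pd_mat :: "real ^ 't ^ 't \<Rightarrow> bool" where
  "pd_mat A \<longleftrightarrow> sym_mat A \<and> (\<forall>v. v \<noteq> 0 \<longrightarrow> 0 < v \<bullet> (A *v v))"

definition K_set :: "('v, 't::finite) pol_mat set \<Rightarrow> (real ^ 'v) set" where
  "K_set \<H> = {x. \<forall>H\<in>\<H>. psd_mat (eval_mat x H)}"

definition qmod_mat :: "('v, 't::finite) pol_mat set \<Rightarrow> ('v, 't) pol_mat set" where
  "qmod_mat \<G> = {\<Sum>k<m. transpose (A k) ** H k ** A k | (m::nat) A H. \<forall>k<m. H k \<in> insert (mat 1) \<G>}"

definition sos :: "'v pol set" where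
  "sos = {\<Sum>k<m. (p k)\<^sup>2 | (m::nat) p. True}"

definition qmod_pol :: "'v pol set \<Rightarrow> 'v pol set" where
  "qmod_pol G = {\<sigma>\<^sub>0 + (\<Sum>i<m. \<sigma> i * g i) | (m::nat) \<sigma>\<^sub>0 \<sigma> g.
     \<sigma>\<^sub>0 \<in> sos \<and> (\<forall>i<m. \<sigma> i \<in> sos \<and> g i \<in> G)}"

definition smult_mat :: "'v pol \<Rightarrow> ('v, 't::finite) pol_mat \<Rightarrow> ('v, 't) pol_mat" where
  "smult_mat p A = map_matrix (\<lambda>a. p * a) A"

text \<open>\<open>mat_power M\<close> is the set \<open>M\<^sup>t\<close>; the size \<open>t\<close> is carried by the result type.\<close>

definition mat_power :: "'v pol set \<Rightarrow> ('v, 't::finite) pol_mat set" where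
  "mat_power M = {\<Sum>k<l. smult_mat (m k) (transpose (A k) ** A k)
     | (l::nat) m (A :: nat \<Rightarrow> ('v, 't) pol_mat). \<forall>k<l. m k \<in> M}"

end

theory Submission
  imports Defs
begin

text \<open>
  If \<open>v\<^sup>T H(x) v < 0\<close> then \<open>g = v\<^sup>T H v\<close> is a scalar polynomial with \<open>g I \<in> \<M>(\<G>)\<close> (sum \<open>A\<^sup>T H A\<close> over
  \<open>A = v e\<^sub>i\<^sup>T\<close>) that excludes a neighbourhood of \<open>x\<close>, and for generic \<open>v\<close> it has the degree of \<open>H\<close>. By
  compactness finitely many such \<open>g\<close> replace \<open>\<G>\<close>. For suitable \<open>c\<close>, \<open>\<lambda>\<close>, \<open>k\<close> the matrix
  \<open>F - c \<Sum> g (1 - \<lambda> g)\<^bsup>2k\<^esup> I\<close>, suitably homogenized, is positive definite everywhere off 0.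

  A positive definite form times a power of \<open>|x|\<^sup>2\<close> is a sum of squares by Polya's theorem: write the form
  in the squares \<open>y = ((x\<^sub>i \<plusminus> x\<^sub>j)/2)\<^sup>2\<close>, which sum to a multiple of \<open>|x|\<^sup>2\<close>. On the simplex of all \<open>y \<ge> 0\<close> it
  need not be positive, but the points coming from some \<open>x\<close> are cut out by equations. These equations are
  additional constraints with zero polynomial, so the compactness argument and the absorption of
  the constraints are carried out on the simplex, where Polya's theorem then applies directly.
\<close>

subsection \<open>Finite sums and quadratic modules\<close>

text \<open>\<open>sos\<close>, \<open>mat_power\<close> and \<open>qmod_mat\<close> all consist of
  finite sums over some set of generators; rewritten in this shape they share closure under addition
  and an induction that adds one summand at a time.\<close>

definition nsums :: "'a::comm_monoid_add set \<Rightarrow> 'a set" where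
  "nsums S = {\<Sum>k<m. f k | (m::nat) f. \<forall>k<m. f k \<in> S}"

lemma nsumsE:
  assumes "x \<in> nsums S"
  obtains m f where "x = (\<Sum>k<(m::nat). f k)" "\<And>k. k < m \<Longrightarrow> f k \<in> S"
  using assms unfolding nsums_def by auto

lemma nsumsI: "(\<And>k. k < m \<Longrightarrow> f k \<in> S) \<Longrightarrow> (\<Sum>k<(m::nat). f k) \<in> nsums S"
  unfolding nsums_def by blast

lemma nsums_zero: "0 \<in> nsums S"
  using nsumsI[of 0 "\<lambda>_. 0" S] by simp

lemma nsums_add_elem:
  assumes "x \<in> nsums S" and "s \<in> S"
  shows "x + s \<in> nsums S"
proof -
  obtain m f where x: "x = (\<Sum>k<(m::nat). f k)" and f: "\<And>k. k < m \<Longrightarrow> f k \<in> S"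
    using assms(1) by (rule nsumsE) blast
  have "(\<Sum>k<Suc m. (f(m := s)) k) \<in> nsums S"
    using f assms(2) by (intro nsumsI) (auto simp: less_Suc_eq)
  moreover have "(\<Sum>k<Suc m. (f(m := s)) k) = x + s"
    unfolding x by (auto intro!: sum.cong)
  ultimately show ?thesis by simp
qed

lemma nsums_elem: "s \<in> S \<Longrightarrow> s \<in> nsums S"
  using nsums_add_elem[OF nsums_zero] by fastforce

lemma nsums_induct [consumes 1, case_names zero add]:
  assumes "x \<in> nsums S" and "P 0"
    and "\<And>y s. y \<in> nsums S \<Longrightarrow> P y \<Longrightarrow> s \<in> S \<Longrightarrow> P (y + s)"
  shows "P x"
proof -
  obtain m f where x: "x = (\<Sum>k<(m::nat). f k)" and f: "\<And>k. k < m \<Longrightarrow> f k \<in> S"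
    using assms(1) by (rule nsumsE) blast
  have "P (\<Sum>k<m. f k)"
    using f by (induction m) (auto intro!: assms nsumsI)
  then show ?thesis by (simp add: x)
qed

lemma nsums_add:
  assumes "x \<in> nsums S" and "y \<in> nsums S"
  shows "x + y \<in> nsums S"
  using assms(2,1)
proof (induction y rule: nsums_induct)
  case (add y s)
  then have "x + y + s \<in> nsums S" using nsums_add_elem by blast
  then show ?case by (simp add: add.assoc)
qed simp

lemma nsums_sum: "(\<And>i. i \<in> I \<Longrightarrow> f i \<in> nsums S) \<Longrightarrow> sum f I \<in> nsums S"
  by (induction I rule: infinite_finite_induct) (auto simp: nsums_zero nsums_add)

lemma sos_nsums: "(sos :: 'v pol set) = nsums (range (\<lambda>p. p\<^sup>2))"
proof (intro set_eqI iffI)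
  fix x :: "'v pol"
  assume "x \<in> sos"
  then obtain m p where x: "x = (\<Sum>k<(m::nat). (p k)\<^sup>2)" unfolding sos_def by blast
  show "x \<in> nsums (range (\<lambda>p. p\<^sup>2))" unfolding x by (rule nsumsI) auto
next
  fix x :: "'v pol"
  assume "x \<in> nsums (range (\<lambda>p. p\<^sup>2))"
  then obtain m f where x: "x = (\<Sum>k<(m::nat). f k)"
    and f: "\<And>k. k < m \<Longrightarrow> f k \<in> range (\<lambda>p. p\<^sup>2)"
    by (rule nsumsE) blast
  have "f k = (SOME p. f k = p\<^sup>2)\<^sup>2" if "k < m" for k
    using someI_ex[of "\<lambda>p. f k = p\<^sup>2"] f[OF that] by blast
  then have "x = (\<Sum>k<m. (SOME p. f k = p\<^sup>2)\<^sup>2)" unfolding x by (intro sum.cong) auto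
  then show "x \<in> sos" unfolding sos_def by (intro CollectI exI conjI TrueI)
qed

lemma sos_square: "p\<^sup>2 \<in> sos"
  unfolding sos_nsums by (rule nsums_elem) auto

lemma sos_sum: "(\<And>i. i \<in> I \<Longrightarrow> f i \<in> sos) \<Longrightarrow> sum f I \<in> sos"
  unfolding sos_nsums by (rule nsums_sum)

lemma sos_mult:
  assumes "x \<in> sos" and "y \<in> (sos :: 'v pol set)"
  shows "x * y \<in> sos"
proof -
  have *: "y * p\<^sup>2 \<in> sos" for p
    using assms(2) unfolding sos_nsums
  proof (induction y rule: nsums_induct)
    case zero
    then show ?case by (simp add: nsums_zero)
  next
    case (add y s)
    from add.hyps obtain q where "s = q\<^sup>2" by auto
    then have "s * p\<^sup>2 = (q * p)\<^sup>2" by (simp add: power_mult_distrib)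
    then have "s * p\<^sup>2 \<in> range (\<lambda>p. p\<^sup>2)" by (rule ssubst) blast
    then show ?case
      using add.IH nsums_add_elem by (simp add: distrib_right)
  qed
  show ?thesis
    using assms(1) unfolding sos_nsums
  proof (induction x rule: nsums_induct)
    case zero
    then show ?case by (simp add: nsums_zero)
  next
    case (add x s)
    from add.hyps have "s * y \<in> nsums (range (\<lambda>p. p\<^sup>2))"
      using * by (auto simp: sos_nsums mult.commute)
    then show ?case
      using add.IH nsums_add by (simp add: distrib_right)
  qed
qed

lemma sos_one: "1 \<in> (sos :: 'v pol set)"
  using sos_square[of 1] by simp

lemma sos_power: "p \<in> sos \<Longrightarrow> p ^ m \<in> (sos :: 'v pol set)"
  by (induction m) (auto simp: sos_one sos_mult)

lemma sos_in_qmod_pol: "s \<in> sos \<Longrightarrow> s \<in> qmod_pol G"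
  unfolding qmod_pol_def by (force intro!: exI[of _ "0::nat"])

lemma sos_mult_in_qmod_pol:
  assumes "s \<in> sos" and "g \<in> G"
  shows "s * g \<in> qmod_pol G"
proof -
  have "0 \<in> (sos :: 'a pol set)" unfolding sos_nsums by (rule nsums_zero)
  then show ?thesis
    unfolding qmod_pol_def using assms
    by (intro CollectI exI[of _ "1::nat"] exI[of _ 0] exI[of _ "\<lambda>_. s"] exI[of _ "\<lambda>_. g"]) simp
qed

lemma mat_power_nsums:
  "mat_power M = nsums {smult_mat m (transpose A ** A) | m (A :: ('v, 't::finite) pol_mat). m \<in> M}"
proof (intro set_eqI iffI)
  fix x :: "('v, 't) pol_mat"
  assume "x \<in> mat_power M"
  then obtain l m and A :: "nat \<Rightarrow> ('v, 't) pol_mat" where x: "x = (\<Sum>k<(l::nat). smult_mat (m k) (transpose (A k) ** A k))"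
    and m: "\<forall>k<l. m k \<in> M"
    unfolding mat_power_def by blast
  show "x \<in> nsums {smult_mat m (transpose A ** A) | m (A :: ('v, 't) pol_mat). m \<in> M}"
    unfolding x by (rule nsumsI) (use m in blast)
next
  fix x :: "('v, 't) pol_mat"
  assume "x \<in> nsums {smult_mat m (transpose A ** A) | m (A :: ('v, 't) pol_mat). m \<in> M}"
  then obtain l f where x: "x = (\<Sum>k<(l::nat). f k)"
    and fS: "\<And>k. k < l \<Longrightarrow> f k \<in> {smult_mat m (transpose A ** A) | m (A :: ('v, 't) pol_mat). m \<in> M}"
    by (rule nsumsE) blast
  have "\<forall>k. \<exists>m (A :: ('v, 't) pol_mat). k < l \<longrightarrow> m \<in> M \<and> f k = smult_mat m (transpose A ** A)" using fS by blast
  then obtain m and A :: "nat \<Rightarrow> ('v, 't) pol_mat" where mA: "\<And>k. k < l \<Longrightarrow> m k \<in> M \<and> f k = smult_mat (m k) (transpose (A k) ** A k)"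
    by metis
  then have "x = (\<Sum>k<l. smult_mat (m k) (transpose (A k) ** A k))"
    unfolding x by (intro sum.cong) auto
  then show "x \<in> mat_power M"
    unfolding mat_power_def using mA by (intro CollectI exI conjI) auto
qed

lemma qmod_mat_nsums:
  "qmod_mat \<G> = nsums {transpose A ** H ** A | A H. H \<in> insert (mat 1) \<G>}"
proof (intro set_eqI iffI)
  fix x :: "('a, 'b) pol_mat"
  assume "x \<in> qmod_mat \<G>"
  then obtain m A H where x: "x = (\<Sum>k<(m::nat). transpose (A k) ** H k ** A k)"
    and H: "\<forall>k<m. H k \<in> insert (mat 1) \<G>"
    unfolding qmod_mat_def by blast
  show "x \<in> nsums {transpose A ** H ** A | A H. H \<in> insert (mat 1) \<G>}"
    unfolding x by (rule nsumsI) (use H in blast)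
next
  fix x :: "('a, 'b) pol_mat"
  assume "x \<in> nsums {transpose A ** H ** A | A H. H \<in> insert (mat 1) \<G>}"
  then obtain m f where x: "x = (\<Sum>k<(m::nat). f k)"
    and "\<And>k. k < m \<Longrightarrow> f k \<in> {transpose A ** H ** A | A H. H \<in> insert (mat 1) \<G>}"
    by (rule nsumsE) blast
  then have "\<forall>k. \<exists>A H. k < m \<longrightarrow> H \<in> insert (mat 1) \<G> \<and> f k = transpose A ** H ** A" by blast
  then obtain A H where
    AH: "\<And>k. k < m \<Longrightarrow> H k \<in> insert (mat 1) \<G> \<and> f k = transpose (A k) ** H k ** A k"
    by metis
  then have "x = (\<Sum>k<m. transpose (A k) ** H k ** A k)"
    unfolding x by (intro sum.cong) auto
  then show "x \<in> qmod_mat \<G>"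
    unfolding qmod_mat_def using AH by (intro CollectI exI conjI) auto
qed

lemma smult_mat_nth [simp]: "smult_mat p A $ i $ j = p * A $ i $ j"
  by (simp add: smult_mat_def map_matrix_def)

lemma smult_mat_add_left: "smult_mat (p + q) A = smult_mat p A + smult_mat q A"
  by (simp add: vec_eq_iff distrib_right)

lemma smult_mat_sum_left: "smult_mat (\<Sum>i\<in>I. f i) A = (\<Sum>i\<in>I. smult_mat (f i) A)"
  by (simp add: vec_eq_iff sum_distrib_right)

lemma transpose_mult_mult_nth:
  "(transpose A ** H ** A) $ i $ j = (\<Sum>k\<in>UNIV. \<Sum>l\<in>UNIV. A $ k $ i * H $ k $ l * (A $ l $ j :: 'a::comm_semiring_1))"
  by (subst sum.swap) (simp add: matrix_matrix_mult_def transpose_def sum_distrib_right)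

subsection \<open>Scalarization\<close>

definition pconst :: "real \<Rightarrow> 'v pol" where
  "pconst c = Poly_Mapping.single 0 c"

lemma pconst_add: "pconst (a + b) = pconst a + pconst b"
  by (simp add: pconst_def single_add)

lemma pconst_mult: "pconst (a * b) = pconst a * pconst b"
  by (simp add: pconst_def mult_single)

lemma pconst_0 [simp]: "pconst 0 = 0" and pconst_1 [simp]: "pconst 1 = 1"
  by (simp_all add: pconst_def)

lemma pconst_minus: "pconst (- a) = - pconst a"
  by (simp add: pconst_def single_uminus)

lemma pconst_sum: "pconst (\<Sum>i\<in>I. f i) = (\<Sum>i\<in>I. pconst (f i))"
  by (induction I rule: infinite_finite_induct) (auto simp: pconst_add)

lemma pconst_power: "pconst (a ^ m) = pconst a ^ m"
  by (induction m) (auto simp: pconst_mult)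

lemma lookup_pconst_mult: "Poly_Mapping.lookup (pconst c * p) \<alpha> = c * Poly_Mapping.lookup p \<alpha>"
  unfolding pconst_def mult_map_scale_conv_mult[symmetric]
  by (simp add: Poly_Mapping.map.rep_eq when_def)

lemma pconst_sos:
  assumes "c \<ge> 0"
  shows "pconst c \<in> (sos :: 'v pol set)"
proof -
  have "pconst c = (pconst (sqrt c) :: 'v pol)\<^sup>2"
    using assms by (simp flip: pconst_power)
  then show ?thesis using sos_square by metis
qed

definition quad_pol :: "real ^ 't \<Rightarrow> ('v, 't::finite) pol_mat \<Rightarrow> 'v pol" where
  "quad_pol v H = (\<Sum>i\<in>UNIV. \<Sum>j\<in>UNIV. pconst (v $ i * v $ j) * H $ i $ j)"

text \<open>Everything is additive in the multiplier of \<open>transpose A ** A\<close>, so only the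
  multipliers \<open>p\<^sup>2\<close> and \<open>p\<^sup>2 * g\<close> matter. The first is
  absorbed into \<open>A\<close>, giving a congruence of the identity; the second gives a sum of
  congruences of \<open>H\<close>.\<close>

lemma mat_power_subset_qmod_mat:
  assumes G: "\<And>g. g \<in> G \<Longrightarrow> \<exists>v. \<exists>H\<in>\<G>. g = quad_pol v H"
  shows "mat_power (qmod_pol G) \<subseteq> qmod_mat \<G>"
proof -
  let ?S = "{transpose A ** H ** A | A H. H \<in> insert (mat 1) \<G>}"
  have sq: "smult_mat (p\<^sup>2) (transpose A ** A) \<in> nsums ?S" for p and A :: "('a, 'b) pol_mat"
  proof -
    have "smult_mat (p\<^sup>2) (transpose A ** A)
        = transpose (smult_mat p A) ** mat 1 ** smult_mat p A"
      unfolding matrix_mul_rid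
      by (simp add: vec_eq_iff matrix_matrix_mult_def transpose_def sum_distrib_left
          power2_eq_square mult_ac)
    then show ?thesis by (intro nsums_elem) blast
  qed
  have sqg: "smult_mat (p\<^sup>2 * g) (transpose A ** A) \<in> nsums ?S" if gG: "g \<in> G"
    for p g and A :: "('a, 'b) pol_mat"
  proof -
    obtain v H where H: "H \<in> \<G>" and g: "g = quad_pol v H" using G[OF gG] by blast
    \<comment> \<open>\<open>B l\<close> is p v a with a the \<open>l\<close>-th row of
      \<open>A\<close>, so its congruence of \<open>H\<close> is p^2 (v^T H v) a^T a. Summation over
      the rows turns a^T a into \<open>transpose A ** A\<close>.\<close>
    define B :: "'b \<Rightarrow> ('a, 'b) pol_mat" where "B l = (\<chi> i j. p * pconst (v $ i) * A $ l $ j)" for l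
    have "smult_mat (p\<^sup>2 * g) (transpose A ** A) $ i $ j
        = (\<Sum>l\<in>UNIV. transpose (B l) ** H ** B l) $ i $ j" for i j
    proof -
      have "smult_mat (p\<^sup>2 * g) (transpose A ** A) $ i $ j
          = (\<Sum>l\<in>UNIV. p\<^sup>2 * g * (A $ l $ i * A $ l $ j))"
        by (simp add: matrix_matrix_mult_def transpose_def sum_distrib_left)
      also have "\<dots> = (\<Sum>l\<in>UNIV. \<Sum>k\<in>UNIV. \<Sum>k'\<in>UNIV. B l $ k $ i * H $ k $ k' * B l $ k' $ j)"
        unfolding g quad_pol_def B_def
        by (simp add: sum_distrib_left sum_distrib_right pconst_mult power2_eq_square mult_ac)
      also have "\<dots> = (\<Sum>l\<in>UNIV. (transpose (B l) ** H ** B l) $ i $ j)"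
        by (simp add: transpose_mult_mult_nth)
      finally show ?thesis by simp
    qed
    then have eq: "smult_mat (p\<^sup>2 * g) (transpose A ** A) = (\<Sum>l\<in>UNIV. transpose (B l) ** H ** B l)"
      by (simp add: vec_eq_iff)
    show ?thesis unfolding eq
      by (intro nsums_sum nsums_elem) (use H in blast)
  qed
  have s: "smult_mat \<sigma> (transpose A ** A) \<in> nsums ?S" if "\<sigma> \<in> sos"
    for \<sigma> and A :: "('a, 'b) pol_mat"
    using that unfolding sos_nsums
  proof (induction \<sigma> rule: nsums_induct)
    case zero
    have "smult_mat 0 (transpose A ** A) = 0" by (simp add: vec_eq_iff)
    then show ?case by (simp add: nsums_zero)
  next
    case (add y s)
    then show ?case using sq by (auto simp: smult_mat_add_left intro!: nsums_add)
  qed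
  have sg: "smult_mat (\<sigma> * g) (transpose A ** A) \<in> nsums ?S" if "\<sigma> \<in> sos" "g \<in> G"
    for \<sigma> g and A :: "('a, 'b) pol_mat"
    using that(1) unfolding sos_nsums
  proof (induction \<sigma> rule: nsums_induct)
    case zero
    have "smult_mat 0 (transpose A ** A) = 0" by (simp add: vec_eq_iff)
    then show ?case by (simp add: nsums_zero)
  next
    case (add y s)
    then show ?case using sqg[OF that(2)]
      by (auto simp: smult_mat_add_left distrib_right intro!: nsums_add)
  qed
  have m: "smult_mat m (transpose A ** A) \<in> nsums ?S" if mG: "m \<in> qmod_pol G"
    for m and A :: "('a, 'b) pol_mat"
  proof -
    obtain k \<sigma>\<^sub>0 \<sigma> g where m: "m = \<sigma>\<^sub>0 + (\<Sum>i<(k::nat). \<sigma> i * g i)"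
      and \<sigma>: "\<sigma>\<^sub>0 \<in> sos" "\<forall>i<k. \<sigma> i \<in> sos \<and> g i \<in> G"
      using mG unfolding qmod_pol_def by blast
    show ?thesis
      unfolding m smult_mat_add_left smult_mat_sum_left
      by (intro nsums_add nsums_sum s sg) (use \<sigma> in auto)
  qed
  show ?thesis
  proof
    fix x :: "('a, 'b) pol_mat"
    assume "x \<in> mat_power (qmod_pol G)"
    then show "x \<in> qmod_mat \<G>"
      unfolding mat_power_nsums qmod_mat_nsums
    proof (induction x rule: nsums_induct)
      case (add y s)
      from add.hyps(2) show ?case using nsums_add[OF add.IH m] by blast
    qed (rule nsums_zero)
  qed
qed

subsection \<open>Positive semidefinite real matrices\<close>

lemma mat_quadratic_form: "v \<bullet> ((A :: real ^ 't ^ 't) *v u) = (\<Sum>i\<in>UNIV. \<Sum>j\<in>UNIV. v $ i * u $ j * A $ i $ j)"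
  by (simp add: inner_vec_def matrix_vector_mult_def sum_distrib_left mult_ac)

definition outer :: "real ^ 't \<Rightarrow> real ^ 't ^ 't" where
  "outer v = (\<chi> i j. v $ i * v $ j)"

lemma sym_inner: "sym_mat A \<Longrightarrow> u \<bullet> (A *v v) = v \<bullet> (A *v (u :: real ^ 't))"
  by (metis sym_mat_def dot_lmul_matrix inner_commute vector_transpose_matrix)

text \<open>The discriminant argument: the form is nonnegative at all s u + t v, and (s, t) = (c,
  -b) settles the case c > 0. A merely semidefinite form may have c = 0, which is treated
  apart.\<close>

lemma psd_Cauchy_Schwarz:
  assumes "psd_mat A"
  shows "(u \<bullet> (A *v v))\<^sup>2 \<le> (u \<bullet> (A *v u)) * (v \<bullet> (A *v (v :: real ^ 't)))"
proof -
  define a b c where "a = u \<bullet> (A *v u)" and "b = u \<bullet> (A *v v)" and "c = v \<bullet> (A *v v)"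
  have sym: "v \<bullet> (A *v u) = b" 
    using assms sym_inner unfolding b_def psd_mat_def by blast
  have q: "0 \<le> s\<^sup>2 * a + 2 * s * t * b + t\<^sup>2 * c" for s t
  proof -
    have "0 \<le> (s *\<^sub>R u + t *\<^sub>R v) \<bullet> (A *v (s *\<^sub>R u + t *\<^sub>R v))"
      using assms unfolding psd_mat_def by blast
    also have "\<dots> = s\<^sup>2 * a + 2 * s * t * b + t\<^sup>2 * c"
      by (simp add: matrix_vector_right_distrib matrix_vector_mult_scaleR inner_add_left inner_add_right
          sym power2_eq_square algebra_simps flip: a_def b_def c_def)
    finally show ?thesis .
  qed
  have c0: "c \<ge> 0" using q[of 0 1] by simp
  show ?thesis
  proof (cases "c = 0")
    case True
    have "b = 0"
    proof (rule ccontr)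
      assume "b \<noteq> 0"
      \<comment> \<open>With c = 0 the value at s = 1 is a + 2 t b, and this t makes it -1.\<close>
      then show False using q[of 1 "- (a + 1) / (2 * b)"] True by (simp add: field_simps)
    qed
    then show ?thesis unfolding a_def[symmetric] b_def[symmetric] c_def[symmetric] using True by simp
  next
    case False
    then have "c > 0" using c0 by simp
    have "0 \<le> c * (a * c - b\<^sup>2)"
      using q[of c "-b"] by (simp add: power2_eq_square algebra_simps)
    then have "b\<^sup>2 \<le> a * c" using \<open>c > 0\<close> by (simp add: zero_le_mult_iff)
    then show ?thesis unfolding a_def b_def c_def .
  qed
qed

text \<open>Cholesky elimination. By Cauchy-Schwarz a nonzero \<open>B\<close> has a positive
  diagonal entry. Subtracting the outer product of that row, divided by the root of the pivot,
  leaves the Schur complement, which is again positive semidefinite and has fewer nonzero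
  rows.\<close>

lemma psd_sum_outer:
  fixes B :: "real ^ 't::finite ^ 't"
  assumes "psd_mat B"
  shows "B \<in> nsums (range outer)"
  using assms
proof (induction "card {i. B $ i \<noteq> 0}" arbitrary: B rule: less_induct)
  case less
  show ?case
  proof (cases "B = 0")
    case True
    then show ?thesis by (simp add: nsums_zero)
  next
    case False
    have diag: "axis i 1 \<bullet> (B *v axis j 1) = B $ i $ j" for i j
      by (simp add: matrix_vector_mul_component inner_axis inner_axis' )
    have ex: "\<exists>i. B $ i $ i \<noteq> 0"
    proof (rule ccontr)
      assume "\<nexists>i. B $ i $ i \<noteq> 0"
      then have "(B $ i $ j)\<^sup>2 \<le> 0" for i j
        using psd_Cauchy_Schwarz[OF less.prems, of "axis i 1" "axis j 1"] by (simp add: diag)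
      then have "B = 0" by (simp add: vec_eq_iff)
      then show False using False by simp
    qed
    then obtain p where "B $ p $ p \<noteq> 0" by blast
    moreover have "B $ p $ p \<ge> 0" using less.prems diag[of p p] unfolding psd_mat_def by metis
    ultimately have p: "B $ p $ p > 0" by simp
    have sym: "B $ i $ j = B $ j $ i" for i j
      using less.prems unfolding psd_mat_def sym_mat_def
      by (metis (no_types, lifting) transpose_def vec_lambda_beta)
    define v where "v = (1 / sqrt (B $ p $ p)) *\<^sub>R (B $ p)"
    define B' where "B' = B - outer v"
    have B': "B' $ i $ j = B $ i $ j - B $ p $ i * B $ p $ j / B $ p $ p" for i j
      using p by (simp add: B'_def outer_def v_def)
    have "psd_mat B'"
      unfolding psd_mat_def
    proof (intro conjI allI)
      show "sym_mat B'" unfolding sym_mat_def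
        by (simp add: vec_eq_iff transpose_def B' sym mult.commute)
      fix u :: "real ^ 't"
      have *: "(axis p 1 \<bullet> (B *v u)) = (\<Sum>i\<in>UNIV. B $ p $ i * u $ i)"
        by (simp add: inner_axis' matrix_vector_mult_def)
      have "u \<bullet> (B' *v u) = u \<bullet> (B *v u) - (axis p 1 \<bullet> (B *v u))\<^sup>2 / B $ p $ p"
        unfolding *
        unfolding mat_quadratic_form B' power2_eq_square sum_product sum_divide_distrib
        by (simp add: right_diff_distrib sum_subtractf mult_ac)
      moreover have "(axis p 1 \<bullet> (B *v u))\<^sup>2 / B $ p $ p \<le> u \<bullet> (B *v u)"
        using psd_Cauchy_Schwarz[OF less.prems, of "axis p 1" u] p
        by (simp add: diag divide_le_eq mult.commute)
      ultimately show "0 \<le> u \<bullet> (B' *v u)" by simp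
    qed
    moreover have "card {i. B' $ i \<noteq> 0} < card {i. B $ i \<noteq> 0}"
    proof (rule psubset_card_mono)
      have z: "B' $ i = 0" if "B $ i = 0" for i
        using that sym[of p i] by (simp add: vec_eq_iff B')
      have "B' $ p = 0" using p by (simp add: vec_eq_iff B')
      moreover have "B $ p \<noteq> 0" using p by auto
      ultimately show "{i. B' $ i \<noteq> 0} \<subset> {i. B $ i \<noteq> 0}" using z by blast
    qed simp
    ultimately have "B' \<in> nsums (range outer)" using less.hyps by blast
    then have "B' + outer v \<in> nsums (range outer)" by (rule nsums_add_elem) blast
    then show ?thesis by (simp add: B'_def)
  qed
qed

subsection \<open>Forms in nonnegative generators\<close>

abbreviation words :: "nat \<Rightarrow> (nat \<Rightarrow> 'k) set" where
  "words r \<equiv> {..<r} \<rightarrow>\<^sub>E UNIV"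

lemma finite_words [simp]: "finite (words r :: (nat \<Rightarrow> 'k::finite) set)"
  by (rule finite_PiE) auto

text \<open>A form \<open>h\<close> of degree \<open>r\<close> is recorded together with its value \<open>P\<close> at the polynomials \<open>Y\<close>.
  Coefficients are indexed by words rather than exponent vectors; they are not unique.\<close>

definition form :: "('k::finite \<Rightarrow> 'v pol) \<Rightarrow> nat \<Rightarrow> (real ^ 'k \<Rightarrow> real) \<Rightarrow> 'v pol \<Rightarrow> bool" where
  "form Y r h P \<longleftrightarrow> (\<exists>a. (\<forall>y. h y = (\<Sum>w\<in>words r. a w * (\<Prod>j<r. y $ w j))) \<and>
     P = (\<Sum>w\<in>words r. pconst (a w) * (\<Prod>j<r. Y (w j))))"

lemma formI:
  assumes "\<And>y. h y = (\<Sum>w\<in>words r. a w * (\<Prod>j<r. y $ w j))"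
    and "P = (\<Sum>w\<in>words r. pconst (a w) * (\<Prod>j<r. Y (w j)))"
  shows "form Y r h P"
  unfolding form_def using assms by blast

lemma form_const: "form Y 0 (\<lambda>_. c) (pconst c)"
  by (rule formI[where a = "\<lambda>_. c"]) auto

lemma form_var:
  fixes k :: "'k::finite"
  shows "form Y 1 (\<lambda>y. y $ k) (Y k)"
proof (rule formI[where a = "\<lambda>w. if w 0 = k then 1 else 0"])
  have words1: "words 1 = range (\<lambda>k :: 'k. (\<lambda>_. undefined)(0 := k))"
  proof (intro equalityI subsetI)
    fix w :: "nat \<Rightarrow> 'k"
    assume "w \<in> words 1"
    then have "w = (\<lambda>_. undefined)(0 := w 0)" by (auto simp: fun_eq_iff PiE_def extensional_def)
    then show "w \<in> range (\<lambda>k. (\<lambda>_. undefined)(0 := k))" by blast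
  next
    fix w :: "nat \<Rightarrow> 'k"
    assume "w \<in> range (\<lambda>k. (\<lambda>_. undefined)(0 := k))"
    then show "w \<in> words 1" by (auto simp: PiE_def extensional_def)
  qed
  have inj: "inj (\<lambda>k. (\<lambda>_. undefined)(0::nat := k :: 'k))"
    by (rule injI) (metis fun_upd_same)
  show "y $ k = (\<Sum>w\<in>words 1. (if w 0 = k then 1 else 0) * (\<Prod>j<1. y $ w j))" for y :: "real ^ 'k"
    unfolding words1 sum.reindex[OF inj]
    by (simp add: if_distrib[of "\<lambda>x. x * _"] cong: if_cong)
  show "Y k = (\<Sum>w\<in>words 1. pconst (if w 0 = k then 1 else 0) * (\<Prod>j<1. Y (w j)))"
    unfolding words1 sum.reindex[OF inj]
    by (simp add: if_distrib[of "\<lambda>x. x * _"] if_distrib[of pconst] cong: if_cong)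
qed

lemma form_add:
  assumes "form Y r h P" and "form Y r h' P'"
  shows "form Y r (\<lambda>y. h y + h' y) (P + P')"
proof -
  obtain a a' where "\<forall>y. h y = (\<Sum>w\<in>words r. a w * (\<Prod>j<r. y $ w j))"
     "P = (\<Sum>w\<in>words r. pconst (a w) * (\<Prod>j<r. Y (w j)))"
     "\<forall>y. h' y = (\<Sum>w\<in>words r. a' w * (\<Prod>j<r. y $ w j))"
     "P' = (\<Sum>w\<in>words r. pconst (a' w) * (\<Prod>j<r. Y (w j)))"
    using assms unfolding form_def by blast
  then show ?thesis
    by (intro formI[where a = "\<lambda>w. a w + a' w"]) (auto simp: pconst_add distrib_right sum.distrib)
qed

text \<open>Splitting a word of length \<open>r + s\<close> into its first \<open>r\<close> and last
  \<open>s\<close> letters is a bijection onto pairs of words. The semiring is left general because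
  \<open>form_mult\<close> needs the identity for real values and for polynomials alike.\<close>

lemma sum_words_concat:
  fixes f :: "'k::finite \<Rightarrow> 'b::comm_semiring_1" and a a' :: "(nat \<Rightarrow> 'k) \<Rightarrow> 'b"
  shows "(\<Sum>w\<in>words r. a w * (\<Prod>j<r. f (w j))) * (\<Sum>u\<in>words s. a' u * (\<Prod>j<s. f (u j)))
    = (\<Sum>w\<in>words (r + s). a (restrict w {..<r}) * a' (restrict (\<lambda>j. w (r + j)) {..<s})
         * (\<Prod>j<r + s. f (w j)))"
proof -
  have split: "(\<Prod>j<r + s. g j) = (\<Prod>j<r. g j) * (\<Prod>j<s. g (r + j))" for g :: "nat \<Rightarrow> 'b"
    by (induction s) (auto simp: mult_ac)
  have "(\<Sum>w\<in>words r. a w * (\<Prod>j<r. f (w j))) * (\<Sum>u\<in>words s. a' u * (\<Prod>j<s. f (u j)))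
    = (\<Sum>(w, u)\<in>words r \<times> words s. a w * a' u * ((\<Prod>j<r. f (w j)) * (\<Prod>j<s. f (u j))))"
    by (simp add: sum_product sum.cartesian_product mult_ac)
  also have "\<dots> = (\<Sum>w\<in>words (r + s). a (restrict w {..<r}) * a' (restrict (\<lambda>j. w (r + j)) {..<s})
         * (\<Prod>j<r + s. f (w j)))"
  proof (rule sum.reindex_bij_witness[where
        i = "\<lambda>w. (restrict w {..<r}, restrict (\<lambda>j. w (r + j)) {..<s})" and
        j = "\<lambda>(w, u). restrict (\<lambda>j. if j < r then w j else u (j - r)) {..<r + s}"], goal_cases)
    case (1 p)
    obtain w u where p: "p = (w, u)" by (cases p)
    with 1 show ?case by (auto simp: fun_eq_iff PiE_def extensional_def)
  next
    case (2 p)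
    then show ?case by (auto simp: PiE_def)
  next
    case (3 w)
    then show ?case by (auto simp: fun_eq_iff PiE_def extensional_def)
  next
    case (4 w)
    then show ?case by auto
  next
    case (5 p)
    obtain w u where p: "p = (w, u)" by (cases p)
    have w: "restrict (restrict (\<lambda>j. if j < r then w j else u (j - r)) {..<r + s}) {..<r} = w"
      using 5 p by (auto simp: fun_eq_iff PiE_def extensional_def)
    have u: "restrict (\<lambda>j. restrict (\<lambda>j. if j < r then w j else u (j - r)) {..<r + s} (r + j)) {..<s} = u"
      using 5 p by (auto simp: fun_eq_iff PiE_def extensional_def)
    have "(\<Prod>j<r + s. f (restrict (\<lambda>j. if j < r then w j else u (j - r)) {..<r + s} j))
        = (\<Prod>j<r. f (w j)) * (\<Prod>j<s. f (u j))"
      unfolding split by (intro arg_cong2[of _ _ _ _ "(*)"] prod.cong) auto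
    then show ?case unfolding p prod.case w u by simp
  qed
  finally show ?thesis .
qed

lemma form_mult:
  assumes "form Y r h P" and "form Y s h' P'"
  shows "form Y (r + s) (\<lambda>y. h y * h' y) (P * P')"
proof -
  obtain a a' where *: "\<forall>y. h y = (\<Sum>w\<in>words r. a w * (\<Prod>j<r. y $ w j))"
     "P = (\<Sum>w\<in>words r. pconst (a w) * (\<Prod>j<r. Y (w j)))"
     "\<forall>y. h' y = (\<Sum>w\<in>words s. a' w * (\<Prod>j<s. y $ w j))"
     "P' = (\<Sum>w\<in>words s. pconst (a' w) * (\<Prod>j<s. Y (w j)))"
    using assms unfolding form_def by blast
  show ?thesis
  proof (rule formI)
    show "h y * h' y = (\<Sum>w\<in>words (r + s). (a (restrict w {..<r}) * a' (restrict (\<lambda>j. w (r + j)) {..<s}))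
         * (\<Prod>j<r + s. y $ w j))" for y
      unfolding *(1,3)[rule_format] by (rule sum_words_concat)
    show "P * P' = (\<Sum>w\<in>words (r + s). pconst (a (restrict w {..<r}) * a' (restrict (\<lambda>j. w (r + j)) {..<s}))
         * (\<Prod>j<r + s. Y (w j)))"
      unfolding *(2,4) pconst_mult by (rule sum_words_concat)
  qed
qed

lemma form_scale: "form Y r h P \<Longrightarrow> form Y r (\<lambda>y. c * h y) (pconst c * P)"
  using form_mult[OF form_const, of Y r h P c] by simp

lemma form_diff: "form Y r h P \<Longrightarrow> form Y r h' P' \<Longrightarrow> form Y r (\<lambda>y. h y - h' y) (P - P')"
  using form_add[of Y r h P "\<lambda>y. - 1 * h' y" "pconst (- 1) * P'"] form_scale[of Y r h' P' "- 1"]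
  by (simp add: pconst_minus)

lemma form_zero: "form Y r (\<lambda>_. 0) 0"
  by (rule formI[where a = "\<lambda>_. 0"]) auto

lemma form_sum:
  "(\<And>i. i \<in> I \<Longrightarrow> form Y r (h i) (P i)) \<Longrightarrow> form Y r (\<lambda>y. \<Sum>i\<in>I. h i y) (\<Sum>i\<in>I. P i)"
  by (induction I rule: infinite_finite_induct) (auto simp: form_zero form_add)

lemma form_power: "form Y r h P \<Longrightarrow> form Y (m * r) (\<lambda>y. h y ^ m) (P ^ m)"
proof (induction m)
  case 0
  then show ?case using form_const[of Y 1] by simp
next
  case (Suc m)
  then show ?case using form_mult[of Y r h P "m * r" "\<lambda>y. h y ^ m" "P ^ m"] by simp
qed

lemma form_total: "form Y 1 (\<lambda>y. \<Sum>k\<in>UNIV. y $ k) (\<Sum>k\<in>UNIV. Y k)"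
  by (intro form_sum form_var)

lemma form_continuous:
  assumes "form Y r h P"
  shows "continuous_on A h"
proof -
  obtain a where "\<forall>y. h y = (\<Sum>w\<in>words r. a w * (\<Prod>j<r. y $ w j))"
    using assms unfolding form_def by blast
  then have "h = (\<lambda>y. \<Sum>w\<in>words r. a w * (\<Prod>j<r. y $ w j))" by blast
  then show ?thesis by (auto intro!: continuous_intros)
qed

subsection \<open>Polya's theorem for matrix forms\<close>

text \<open>A noninjective map takes equal values at some pair of distinct positions. There are at
  most \<open>D\<^sup>2\<close> pairs, and for a given pair the map is determined by its restriction
  away from the second position.\<close>

lemma card_noninjective_words:
  assumes "M > 0"
  shows "card {\<iota> \<in> {..<D} \<rightarrow>\<^sub>E {..<M}. \<not> inj_on \<iota> {..<D}} \<le> D\<^sup>2 * M ^ (D - 1)"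
proof -
  define S where "S p = {\<iota> \<in> {..<D} \<rightarrow>\<^sub>E {..<M}. \<iota> (fst p) = \<iota> (snd p)}" for p :: "nat \<times> nat"
  let ?I = "{p \<in> {..<D} \<times> {..<D}. fst p \<noteq> snd p}"
  have fin: "finite ({..<D} \<rightarrow>\<^sub>E {..<M})" by (rule finite_PiE) auto
  have "{\<iota> \<in> {..<D} \<rightarrow>\<^sub>E {..<M}. \<not> inj_on \<iota> {..<D}} \<subseteq> (\<Union>p\<in>?I. S p)"
  proof
    fix \<iota> assume \<iota>: "\<iota> \<in> {\<iota> \<in> {..<D} \<rightarrow>\<^sub>E {..<M}. \<not> inj_on \<iota> {..<D}}"
    then obtain i j where "i < D" "j < D" "i \<noteq> j" "\<iota> i = \<iota> j" by (auto simp: inj_on_def)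
    then have "(i, j) \<in> ?I" and "\<iota> \<in> S (i, j)" using \<iota> by (simp_all add: S_def)
    then show "\<iota> \<in> (\<Union>p\<in>?I. S p)" by blast
  qed
  then have "card {\<iota> \<in> {..<D} \<rightarrow>\<^sub>E {..<M}. \<not> inj_on \<iota> {..<D}} \<le> card (\<Union>p\<in>?I. S p)"
    by (intro card_mono finite_UN_I) (simp_all add: S_def fin)
  also have "\<dots> \<le> (\<Sum>p\<in>?I. card (S p))" by (rule card_UN_le) auto
  also have "\<dots> \<le> (\<Sum>p\<in>?I. M ^ (D - 1))"
  proof (rule sum_mono)
    fix p assume p: "p \<in> ?I"
    have "inj_on (\<lambda>\<iota>. restrict \<iota> ({..<D} - {snd p})) (S p)"
    proof (rule inj_onI)
      fix f g assume f: "f \<in> S p" and g: "g \<in> S p"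
        and eq: "restrict f ({..<D} - {snd p}) = restrict g ({..<D} - {snd p})"
      have eq': "f j = g j" if "j < D" "j \<noteq> snd p" for j
        using fun_cong[OF eq, of j] that by simp
      have "f j = g j" if "j < D" for j
        using eq'[OF that] eq'[of "fst p"] p f g by (cases "j = snd p") (simp_all add: S_def mem_Times_iff)
      moreover have "f \<in> {..<D} \<rightarrow>\<^sub>E {..<M}" "g \<in> {..<D} \<rightarrow>\<^sub>E {..<M}" using f g by (simp_all add: S_def)
      ultimately show "f = g" by (metis PiE_ext lessThan_iff)
    qed
    moreover have "(\<lambda>\<iota>. restrict \<iota> ({..<D} - {snd p})) ` S p \<subseteq> ({..<D} - {snd p}) \<rightarrow>\<^sub>E {..<M}"
      unfolding S_def by (intro image_subsetI restrict_PiE_iff[THEN iffD2] ballI) (blast dest: PiE_mem)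
    ultimately have "card (S p) \<le> card (({..<D} - {snd p}) \<rightarrow>\<^sub>E {..<M})"
      by (rule card_inj_on_le) (simp add: finite_PiE)
    also have "\<dots> = M ^ (D - 1)" using p by (simp add: card_PiE mem_Times_iff)
    finally show "card (S p) \<le> M ^ (D - 1)" .
  qed
  also have "\<dots> = card ?I * M ^ (D - 1)" by simp
  also have "\<dots> \<le> card ({..<D} \<times> {..<D}) * M ^ (D - 1)"
    by (intro mult_right_mono card_mono) auto
  also have "\<dots> = D\<^sup>2 * M ^ (D - 1)" by (simp add: power2_eq_square)
  finally show ?thesis .
qed

text \<open>The letters of \<open>w'\<close> at the positions in the image of \<open>\<iota>\<close>
  spell the subword, while the other \<open>M - D\<close> letters run freely and each contributes a
  factor \<open>\<Sum>k\<in>UNIV. Y k\<close>.\<close>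

lemma sum_words_subword:
  fixes Y :: "'k::finite \<Rightarrow> 'b::comm_ring_1"
  assumes \<iota>: "\<iota> \<in> {..<D} \<rightarrow>\<^sub>E {..<M}" "inj_on \<iota> {..<D}"
  shows "(\<Sum>w'\<in>words M. a (restrict (w' \<circ> \<iota>) {..<D}) * (\<Prod>l<M. Y (w' l)))
    = (\<Sum>k\<in>UNIV. Y k) ^ (M - D) * (\<Sum>w\<in>words D. a w * (\<Prod>j<D. Y (w j)))"
proof -
  have sub: "\<iota> ` {..<D} \<subseteq> {..<M}" using \<iota>(1) by auto
  have cardc: "card ({..<M} - \<iota> ` {..<D}) = M - D"
    using card_Diff_subset[OF _ sub] card_image[OF \<iota>(2)] by simp
  \<comment> \<open>The letters allowed at position \<open>l\<close> once the subword is
    \<open>w\<close>. Each fibre is thus a product set, so the sum over it factors over the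
    positions.\<close>
  define B where "B w l = (if l \<in> \<iota> ` {..<D} then {w (the_inv_into {..<D} \<iota> l)} else UNIV)" 
    for w :: "nat \<Rightarrow> 'k" and l
  have fib: "{w' \<in> words M. restrict (w' \<circ> \<iota>) {..<D} = w} = PiE {..<M} (B w)" if w: "w \<in> words D" for w
  proof (intro set_eqI iffI)
    fix w' assume w': "w' \<in> {w' \<in> words M. restrict (w' \<circ> \<iota>) {..<D} = w}"
    have "w' (\<iota> j) = w j" if "j < D" for j
    proof -
      have r: "w = restrict (w' \<circ> \<iota>) {..<D}" using w' by simp
      show ?thesis unfolding r using that by simp
    qed
    then have "w' l \<in> B w l" for l
      unfolding B_def by (auto simp: the_inv_into_f_f[OF \<iota>(2)])
    then show "w' \<in> PiE {..<M} (B w)"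
      using w' by (simp add: PiE_def)
  next
    fix w' assume w': "w' \<in> PiE {..<M} (B w)"
    have "w' (\<iota> j) = w j" if "j < D" for j
    proof -
      have "\<iota> j \<in> {..<M}" using sub that by blast
      then have "w' (\<iota> j) \<in> B w (\<iota> j)" using w' by (rule PiE_mem[rotated])
      then show ?thesis using that by (simp add: B_def the_inv_into_f_f[OF \<iota>(2)])
    qed
    then have "restrict (w' \<circ> \<iota>) {..<D} = w"
      using w by (simp add: fun_eq_iff PiE_def extensional_def restrict_def)
    then show "w' \<in> {w' \<in> words M. restrict (w' \<circ> \<iota>) {..<D} = w}"
      using w' by (simp add: PiE_def)
  qed
  have "(\<Sum>w'\<in>words M. a (restrict (w' \<circ> \<iota>) {..<D}) * (\<Prod>l<M. Y (w' l)))
      = (\<Sum>w\<in>words D. \<Sum>w'\<in>{w' \<in> words M. restrict (w' \<circ> \<iota>) {..<D} = w}.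
           a (restrict (w' \<circ> \<iota>) {..<D}) * (\<Prod>l<M. Y (w' l)))"
    by (rule sum.group[symmetric]) (simp_all add: image_subset_iff)
  also have "\<dots> = (\<Sum>w\<in>words D. a w * (\<Sum>w'\<in>PiE {..<M} (B w). \<Prod>l<M. Y (w' l)))"
  proof (rule sum.cong[OF refl])
    fix w :: "nat \<Rightarrow> 'k" assume w: "w \<in> words D"
    have "(\<Sum>w'\<in>{w' \<in> words M. restrict (w' \<circ> \<iota>) {..<D} = w}.
           a (restrict (w' \<circ> \<iota>) {..<D}) * (\<Prod>l<M. Y (w' l)))
        = (\<Sum>w'\<in>{w' \<in> words M. restrict (w' \<circ> \<iota>) {..<D} = w}. a w * (\<Prod>l<M. Y (w' l)))"
      by (rule sum.cong[OF refl]) (simp only: mem_Collect_eq)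
    also have "\<dots> = a w * (\<Sum>w'\<in>PiE {..<M} (B w). \<Prod>l<M. Y (w' l))"
      unfolding fib[OF w] sum_distrib_left ..
    finally show "(\<Sum>w'\<in>{w' \<in> words M. restrict (w' \<circ> \<iota>) {..<D} = w}.
           a (restrict (w' \<circ> \<iota>) {..<D}) * (\<Prod>l<M. Y (w' l)))
        = a w * (\<Sum>w'\<in>PiE {..<M} (B w). \<Prod>l<M. Y (w' l))" .
  qed
  also have "\<dots> = (\<Sum>w\<in>words D. a w * ((\<Sum>k\<in>UNIV. Y k) ^ (M - D) * (\<Prod>j<D. Y (w j))))"
  proof (intro sum.cong refl arg_cong2[of _ _ _ _ "(*)"])
    fix w :: "nat \<Rightarrow> 'k"
    have "(\<Sum>w'\<in>PiE {..<M} (B w). \<Prod>l<M. Y (w' l)) = (\<Prod>l<M. \<Sum>k\<in>B w l. Y k)"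
      by (rule prod_sum_PiE[symmetric]) (auto simp: B_def)
    also have "\<dots> = (\<Prod>l\<in>{..<M} - \<iota> ` {..<D}. \<Sum>k\<in>B w l. Y k) * (\<Prod>l\<in>\<iota> ` {..<D}. \<Sum>k\<in>B w l. Y k)"
      by (rule prod.subset_diff[OF sub]) auto
    also have "(\<Prod>l\<in>{..<M} - \<iota> ` {..<D}. \<Sum>k\<in>B w l. Y k) = (\<Sum>k\<in>UNIV. Y k) ^ (M - D)"
      by (simp add: B_def cardc)
    also have "(\<Prod>l\<in>\<iota> ` {..<D}. \<Sum>k\<in>B w l. Y k) = (\<Prod>j<D. Y (w j))"
      unfolding prod.reindex[OF \<iota>(2)] by (simp add: B_def the_inv_into_f_f[OF \<iota>(2)])
    finally show "(\<Sum>w'\<in>PiE {..<M} (B w). \<Prod>l<M. Y (w' l))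
        = (\<Sum>k\<in>UNIV. Y k) ^ (M - D) * (\<Prod>j<D. Y (w j))" .
  qed
  finally show ?thesis by (simp add: sum_distrib_left mult_ac)
qed

text \<open>\<open>real M * y $ k\<close> counts the positions of \<open>w'\<close> that carry
  \<open>k\<close>. Expanding the product of these counts gives a sum over position maps, in which
  \<open>\<iota>\<close> contributes only to the word that it reads off \<open>w'\<close>.\<close>

lemma sum_all_subwords:
  fixes a :: "(nat \<Rightarrow> 'k::finite) \<Rightarrow> real"
  assumes w': "w' \<in> words M" and "M > 0"
  defines "y \<equiv> (\<chi> k. real (card {l. l < M \<and> w' l = k}) / real M)"
  shows "(\<Sum>\<iota>\<in>{..<D} \<rightarrow>\<^sub>E {..<M}. a (restrict (w' \<circ> \<iota>) {..<D}))
    = real M ^ D * (\<Sum>w\<in>words D. a w * (\<Prod>j<D. y $ w j))"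
proof -
  have M: "real M * y $ k = (\<Sum>l<M. if w' l = k then 1 else 0)" for k
    using \<open>M > 0\<close> by (simp add: y_def sum.If_cases Int_def)
  have "real M ^ D * (\<Sum>w\<in>words D. a w * (\<Prod>j<D. y $ w j))
      = (\<Sum>w\<in>words D. a w * (\<Prod>j<D. real M * y $ w j))"
    by (simp add: sum_distrib_left prod.distrib mult_ac)
  also have "\<dots> = (\<Sum>w\<in>words D. a w * (\<Sum>\<iota>\<in>{..<D} \<rightarrow>\<^sub>E {..<M}. \<Prod>j<D. if w' (\<iota> j) = w j then 1 else 0))"
    unfolding M by (subst prod_sum_PiE) auto
  also have "\<dots> = (\<Sum>\<iota>\<in>{..<D} \<rightarrow>\<^sub>E {..<M}. \<Sum>w\<in>words D. a w * (\<Prod>j<D. if w' (\<iota> j) = w j then 1 else 0))"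
    unfolding sum_distrib_left by (rule sum.swap)
  also have "\<dots> = (\<Sum>\<iota>\<in>{..<D} \<rightarrow>\<^sub>E {..<M}. a (restrict (w' \<circ> \<iota>) {..<D}))"
  proof (intro sum.cong refl)
    fix \<iota> assume "\<iota> \<in> {..<D} \<rightarrow>\<^sub>E {..<M}"
    have "(\<Prod>j<D. if w' (\<iota> j) = w j then 1 else (0::real)) = (if w = restrict (w' \<circ> \<iota>) {..<D} then 1 else 0)"
      if wD: "w \<in> words D" for w
    proof (cases "w = restrict (w' \<circ> \<iota>) {..<D}")
      case False
      then obtain j where "j < D" "w' (\<iota> j) \<noteq> w j"
        using wD by (auto simp: fun_eq_iff PiE_def extensional_def split: if_splits) metis
      then show ?thesis using False by (auto intro!: prod_zero)
    qed auto
    then have "(\<Sum>w\<in>words D. a w * (\<Prod>j<D. if w' (\<iota> j) = w j then 1 else 0))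
       = (\<Sum>w\<in>words D. if w = restrict (w' \<circ> \<iota>) {..<D} then a w else 0)"
      by (intro sum.cong) auto
    also have "\<dots> = a (restrict (w' \<circ> \<iota>) {..<D})" by (subst sum.delta) auto
    finally show "(\<Sum>w\<in>words D. a w * (\<Prod>j<D. if w' (\<iota> j) = w j then 1 else 0))
      = a (restrict (w' \<circ> \<iota>) {..<D})" .
  qed
  finally show ?thesis by simp
qed

lemma pconst_of_nat: "pconst (real m) = (of_nat m :: 'v pol)"
  unfolding pconst_def by (rule single_of_nat)

lemma mat_quadratic_form_sum:
  "v \<bullet> ((\<Sum>i\<in>I. A i) *v v) = (\<Sum>i\<in>I. v \<bullet> (A i *v (v :: real ^ 't)))"
  unfolding mat_quadratic_form sum_component sum_distrib_left
  by (subst (2) sum.swap, subst sum.swap) (rule refl)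

text \<open>The coefficient of a word of length \<open>M\<close> is the mean of the coefficients of its subwords along
  injective position maps. The sum over all position maps is \<open>M\<^sup>D\<close> times the value of the form at the
  letter frequencies, and noninjective maps are of lower order in \<open>M\<close>.\<close>

theorem polya_matrix:
  fixes p :: "real ^ 'k \<Rightarrow> real ^ 't ^ 't" and P :: "'t::finite \<Rightarrow> 't \<Rightarrow> 'v pol"
    and Y :: "'k::finite \<Rightarrow> 'v pol"
  assumes form: "\<And>i j. form Y D (\<lambda>y. p y $ i $ j) (P i j)"
    and symp: "\<And>y i j. p y $ i $ j = p y $ j $ i" and symP: "\<And>i j. P i j = P j i"
    and pos: "\<And>y v. (\<And>k. 0 \<le> y $ k) \<Longrightarrow> (\<Sum>k\<in>UNIV. y $ k) = 1 \<Longrightarrow> \<delta> * (norm v)\<^sup>2 \<le> v \<bullet> (p y *v v)"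
    and "\<delta> > 0"
  obtains M B where "M \<ge> D" and "\<And>w. w \<in> words M \<Longrightarrow> psd_mat (B w)"
    and "\<And>i j. (\<Sum>k\<in>UNIV. Y k) ^ (M - D) * P i j
      = (\<Sum>w\<in>words M. pconst (B w $ i $ j) * (\<Prod>l<M. Y (w l)))"
proof -
  define Q where "Q i j a \<longleftrightarrow> (\<forall>y. p y $ i $ j = (\<Sum>w\<in>words D. a w * (\<Prod>j<D. y $ w j))) \<and>
     P i j = (\<Sum>w\<in>words D. pconst (a w) * (\<Prod>j<D. Y (w j)))" for i j a
  have "\<forall>i j. \<exists>a. Q i j a"
    using form unfolding form_def Q_def by blast
  then obtain a where "\<And>i j. Q i j (a i j)" by metis
  then have a: "\<And>i j y. p y $ i $ j = (\<Sum>w\<in>words D. a i j w * (\<Prod>j<D. y $ w j))"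
    and aP: "\<And>i j. P i j = (\<Sum>w\<in>words D. pconst (a i j w) * (\<Prod>j<D. Y (w j)))"
    unfolding Q_def by blast+
  \<comment> \<open>The coefficients of the entries (i, j) and (j, i) were chosen separately and are
    not unique, so they are averaged to make every coefficient matrix symmetric.\<close>
  define A :: "(nat \<Rightarrow> 'k) \<Rightarrow> real ^ 't ^ 't" where "A w = (\<chi> i j. (a i j w + a j i w) / 2)" for w
  have A: "p y $ i $ j = (\<Sum>w\<in>words D. A w $ i $ j * (\<Prod>j<D. y $ w j))" for y i j
  proof -
    have "p y $ i $ j = (p y $ i $ j + p y $ j $ i) / 2" using symp[of y i j] by simp
    also have "\<dots> = (\<Sum>w\<in>words D. A w $ i $ j * (\<Prod>j<D. y $ w j))"
      unfolding a sum.distrib[symmetric] sum_divide_distrib A_def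
      by (intro sum.cong refl) (simp add: add_divide_distrib distrib_right)
    finally show ?thesis .
  qed
  have AP: "P i j = (\<Sum>w\<in>words D. pconst (A w $ i $ j) * (\<Prod>j<D. Y (w j)))" for i j
  proof -
    have half: "pconst (1 / 2) + pconst (1 / 2) = (1 :: 'v pol)"
      by (simp flip: pconst_add)
    have avg: "pconst ((x + y) / 2) = (pconst (1 / 2) * pconst x + pconst (1 / 2) * pconst y :: 'v pol)" for x y
      by (simp add: add_divide_distrib flip: pconst_add pconst_mult)
    have "P i j = (pconst (1 / 2) + pconst (1 / 2)) * P i j" unfolding half by simp
    also have "\<dots> = pconst (1 / 2) * (P i j + P j i)"
      using symP[of i j] by (simp add: algebra_simps)
    also have "\<dots> = (\<Sum>w\<in>words D. pconst (A w $ i $ j) * (\<Prod>j<D. Y (w j)))"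
      unfolding aP[of i j] aP[of j i] sum.distrib[symmetric] sum_distrib_left A_def
      by (intro sum.cong refl) (simp only: avg vec_lambda_beta distrib_left distrib_right mult.assoc)
    finally show ?thesis .
  qed
  define C where "C = (\<Sum>w\<in>words D. \<Sum>i\<in>UNIV. \<Sum>j\<in>UNIV. \<bar>A w $ i $ j\<bar>)"
  have C0: "C \<ge> 0" unfolding C_def by (intro sum_nonneg) auto
  have C: "v \<bullet> (A w *v v) \<le> C * (norm v)\<^sup>2" if "w \<in> words D" for w v
  proof -
    have "v \<bullet> (A w *v v) \<le> (\<Sum>i\<in>UNIV. \<Sum>j\<in>UNIV. (norm v)\<^sup>2 * \<bar>A w $ i $ j\<bar>)"
      unfolding mat_quadratic_form
    proof (intro sum_mono)
      fix i j
      have "v $ i * v $ j * A w $ i $ j \<le> \<bar>v $ i\<bar> * \<bar>v $ j\<bar> * \<bar>A w $ i $ j\<bar>"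
        by (metis abs_ge_self abs_mult)
      also have "\<dots> \<le> norm v * norm v * \<bar>A w $ i $ j\<bar>"
        by (intro mult_mono component_le_norm_cart) auto
      finally show "v $ i * v $ j * A w $ i $ j \<le> (norm v)\<^sup>2 * \<bar>A w $ i $ j\<bar>"
        by (simp add: power2_eq_square)
    qed
    also have "\<dots> = (norm v)\<^sup>2 * (\<Sum>i\<in>UNIV. \<Sum>j\<in>UNIV. \<bar>A w $ i $ j\<bar>)"
      by (simp add: sum_distrib_left)
    also have "\<dots> \<le> (norm v)\<^sup>2 * C"
      unfolding C_def using that
      by (intro mult_left_mono member_le_sum[where f = "\<lambda>w. \<Sum>i\<in>UNIV. \<Sum>j\<in>UNIV. \<bar>A w $ i $ j\<bar>"])
        (auto intro!: sum_nonneg)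
    finally show ?thesis by (simp add: mult.commute)
  qed
  \<comment> \<open>The noninjective maps cost at most D^2 M^(D-1) C |v|^2, while the main term is
    at least M^D \<delta> |v|^2; this lower bound on \<open>M\<close> makes the main term
    dominate.\<close>
  obtain M0 :: nat where M0: "(real D)\<^sup>2 * C / \<delta> \<le> real M0" using real_arch_simple by blast
  define M where "M = M0 + D + 1"
  have M: "M \<ge> D" "M > 0" by (simp_all add: M_def)
  have "(real D)\<^sup>2 * C / \<delta> \<le> real M" using M0 by (simp add: M_def)
  then have MC: "(real D)\<^sup>2 * C \<le> real M * \<delta>" using \<open>\<delta> > 0\<close> by (simp add: divide_le_eq)
  define I where "I = {\<iota> \<in> {..<D} \<rightarrow>\<^sub>E {..<M}. inj_on \<iota> {..<D}}"
  define I' where "I' = {\<iota> \<in> {..<D} \<rightarrow>\<^sub>E {..<M}. \<not> inj_on \<iota> {..<D}}"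
  have fin: "finite ({..<D} \<rightarrow>\<^sub>E {..<M})" by (rule finite_PiE) auto
  then have finI: "finite I" "finite I'" unfolding I_def I'_def by auto
  have "restrict id {..<D} \<in> I" using M by (auto simp: I_def inj_on_def)
  then have N: "card I > 0" using finI card_gt_0_iff by blast
  define S where "S w' = (\<Sum>\<iota>\<in>I. A (restrict (w' \<circ> \<iota>) {..<D}))" for w'
  define B where "B w' = (1 / real (card I)) *\<^sub>R S w'" for w'
  have psd: "psd_mat (B w')" if w': "w' \<in> words M" for w'
    unfolding psd_mat_def
  proof (intro conjI allI)
    show "sym_mat (B w')"
      by (simp add: sym_mat_def transpose_def vec_eq_iff B_def S_def A_def add.commute)
    fix v :: "real ^ 't"
    define q where "q w = v \<bullet> (A w *v v)" for w
    define y :: "real ^ 'k" where "y = (\<chi> k. real (card {l. l < M \<and> w' l = k}) / real M)"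
    have y0: "0 \<le> y $ k" for k by (simp add: y_def)
    have "(\<Sum>k\<in>UNIV. card {l. l < M \<and> w' l = k}) = M"
      using sum.group[of "{..<M}" UNIV w' "\<lambda>_. 1::nat"] by simp
    then have "(\<Sum>k\<in>UNIV. real (card {l. l < M \<and> w' l = k})) = real M"
      by (simp flip: of_nat_sum)
    then have y1: "(\<Sum>k\<in>UNIV. y $ k) = 1"
      using M(2) by (simp add: y_def flip: sum_divide_distrib)
    have "v \<bullet> (p y *v v) = (\<Sum>w\<in>words D. q w * (\<Prod>j<D. y $ w j))"
      unfolding q_def mat_quadratic_form A sum_distrib_left sum_distrib_right
      by (subst (2) sum.swap, subst sum.swap) (simp add: mult.assoc)
    then have "real M ^ D * (v \<bullet> (p y *v v)) = (\<Sum>\<iota>\<in>{..<D} \<rightarrow>\<^sub>E {..<M}. q (restrict (w' \<circ> \<iota>) {..<D}))"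
      using sum_all_subwords[OF w' M(2), of q D] by (simp add: y_def)
    also have "\<dots> = (\<Sum>\<iota>\<in>I. q (restrict (w' \<circ> \<iota>) {..<D})) + (\<Sum>\<iota>\<in>I'. q (restrict (w' \<circ> \<iota>) {..<D}))"
      unfolding I_def I'_def by (subst sum.union_disjoint[symmetric]) (auto simp: fin intro!: sum.cong)
    also have "(\<Sum>\<iota>\<in>I. q (restrict (w' \<circ> \<iota>) {..<D})) = v \<bullet> (S w' *v v)"
      by (simp add: S_def q_def mat_quadratic_form_sum)
    finally have eq: "v \<bullet> (S w' *v v)
        = real M ^ D * (v \<bullet> (p y *v v)) - (\<Sum>\<iota>\<in>I'. q (restrict (w' \<circ> \<iota>) {..<D}))" by (simp only: eq_diff_eq)
    have "(\<Sum>\<iota>\<in>I'. q (restrict (w' \<circ> \<iota>) {..<D})) \<le> (\<Sum>\<iota>\<in>I'. C * (norm v)\<^sup>2)"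
      unfolding q_def by (intro sum_mono C) auto
    also have "\<dots> = real (card I') * (C * (norm v)\<^sup>2)" by simp
    also have "\<dots> \<le> real (D\<^sup>2 * M ^ (D - 1)) * (C * (norm v)\<^sup>2)"
      using card_noninjective_words[OF M(2), of D] C0 unfolding I'_def
      by (intro mult_right_mono) (auto simp del: of_nat_mult of_nat_power)
    also have "\<dots> = ((real D)\<^sup>2 * C) * (real M ^ (D - 1) * (norm v)\<^sup>2)" by simp
    also have "\<dots> \<le> real M ^ D * (\<delta> * (norm v)\<^sup>2)"
    \<comment> \<open>For \<open>D = 0\<close> the truncated exponent \<open>D - 1\<close> does no
      harm because the factor \<open>(real D)\<^sup>2\<close> vanishes.\<close>
    proof (cases D)
      case 0
      then show ?thesis using \<open>\<delta> > 0\<close> by simp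
    next
      case (Suc d)
      have "((real D)\<^sup>2 * C) * (real M ^ (D - 1) * (norm v)\<^sup>2) \<le> (real M * \<delta>) * (real M ^ (D - 1) * (norm v)\<^sup>2)"
        using MC by (intro mult_right_mono) auto
      then show ?thesis by (simp add: Suc mult_ac)
    qed
    also have "\<dots> \<le> real M ^ D * (v \<bullet> (p y *v v))"
      using pos[OF y0 y1, of v] by (intro mult_left_mono) auto
    finally have "0 \<le> v \<bullet> (S w' *v v)" unfolding eq by simp
    then show "0 \<le> v \<bullet> (B w' *v v)"
      by (simp add: B_def scaleR_matrix_vector_assoc[symmetric])
  qed
  have id: "(\<Sum>k\<in>UNIV. Y k) ^ (M - D) * P i j
      = (\<Sum>w\<in>words M. pconst (B w $ i $ j) * (\<Prod>l<M. Y (w l)))" for i j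
  proof -
    have "(\<Sum>w\<in>words M. pconst (B w $ i $ j) * (\<Prod>l<M. Y (w l)))
        = pconst (1 / real (card I)) * (\<Sum>w\<in>words M. \<Sum>\<iota>\<in>I.
            pconst (A (restrict (w \<circ> \<iota>) {..<D}) $ i $ j) * (\<Prod>l<M. Y (w l)))"
      unfolding sum_distrib_left[of _ _ "words M"] sum_distrib_right[symmetric] pconst_sum[symmetric]
      by (simp only: B_def S_def vector_scaleR_component sum_component real_scaleR_def pconst_mult mult.assoc)
    also have "\<dots> = pconst (1 / real (card I)) * (\<Sum>\<iota>\<in>I. \<Sum>w\<in>words M.
            pconst (A (restrict (w \<circ> \<iota>) {..<D}) $ i $ j) * (\<Prod>l<M. Y (w l)))"
      by (subst sum.swap) (rule refl)
    also have "\<dots> = pconst (1 / real (card I)) * (\<Sum>\<iota>\<in>I. (\<Sum>k\<in>UNIV. Y k) ^ (M - D) * P i j)"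
    proof (intro arg_cong2[of _ _ _ _ "(*)"] sum.cong refl)
      fix \<iota> assume "\<iota> \<in> I"
      then show "(\<Sum>w\<in>words M. pconst (A (restrict (w \<circ> \<iota>) {..<D}) $ i $ j) * (\<Prod>l<M. Y (w l)))
          = (\<Sum>k\<in>UNIV. Y k) ^ (M - D) * P i j"
        unfolding AP I_def mem_Collect_eq
        by (intro sum_words_subword[where a = "\<lambda>w. pconst (A w $ i $ j)"]) auto
    qed
    also have "\<dots> = pconst (1 / real (card I)) * pconst (real (card I)) * ((\<Sum>k\<in>UNIV. Y k) ^ (M - D) * P i j)"
      by (simp add: pconst_of_nat mult.assoc)
    also have "\<dots> = (\<Sum>k\<in>UNIV. Y k) ^ (M - D) * P i j"
      using N by (simp flip: pconst_mult)
    finally show ?thesis by simp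
  qed
  show thesis using that[OF M(1) psd id] by blast
qed

subsection \<open>Absorbing finitely many constraints on a compact set\<close>

text \<open>The factor leaves a negative \<open>t\<close> at least as negative and flattens a
  positive one: by Bernoulli, (1 - t)^(2k) (1 + 2kt) \<le> (1 - t^2)^(2k) \<le> 1, so the product is
  at most 1/(2k).\<close>

lemma mult_power_le:
  fixes t :: real
  assumes "\<bar>t\<bar> \<le> 1" and "k > 0"
  shows "t * (1 - t) ^ (2 * k) \<le> 1 / (2 * real k) - max 0 (- t)"
proof (cases "t \<le> 0")
  case True
  have "1 \<le> (1 - t) ^ (2 * k)" using True by (intro one_le_power) simp
  then have "t * (1 - t) ^ (2 * k) \<le> t * 1" using True by (intro mult_left_mono_neg)
  moreover have "0 \<le> 1 / (2 * real k)" by simp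
  moreover have "max 0 (- t) = - t" using True by simp
  ultimately show ?thesis by linarith
next
  case False
  have "1 + real (2 * k) * t \<le> (1 + t) ^ (2 * k)"
    using False by (intro Bernoulli_inequality) simp
  then have "(1 - t) ^ (2 * k) * (1 + real (2 * k) * t) \<le> (1 - t) ^ (2 * k) * (1 + t) ^ (2 * k)"
    by (intro mult_left_mono) auto
  also have "\<dots> = (1 - t\<^sup>2) ^ (2 * k)"
    by (simp add: power_mult_distrib[symmetric] power2_eq_square algebra_simps)
  also have "\<dots> \<le> 1" using assms(1) by (intro power_le_one) (auto simp: abs_square_le_1)
  finally have *: "(1 - t) ^ (2 * k) + 2 * real k * (t * (1 - t) ^ (2 * k)) \<le> 1"
    by (simp add: algebra_simps)
  have "0 \<le> (1 - t) ^ (2 * k)" by simp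
  with * have "2 * real k * (t * (1 - t) ^ (2 * k)) \<le> 1" by linarith
  then have "t * (1 - t) ^ (2 * k) \<le> 1 / (2 * real k)"
    using assms(2) by (simp add: field_simps)
  then show ?thesis using False by simp
qed

text \<open>A penalty argument: adding a large multiple of the sum \<Phi> of the negative parts of
  the constraints makes \<open>f\<close> positive on \<open>Z\<close>. Subtracting
  \<open>h i z * (1 - lam * h i z) ^ (2 * k)\<close> has this effect up to O(1/k), and the even
  power later becomes a square multiplier.\<close>

lemma absorb_constraints:
  fixes f :: "'a::metric_space \<Rightarrow> real" and h :: "'i \<Rightarrow> 'a \<Rightarrow> real"
  assumes Z: "compact Z" and f: "continuous_on Z f" and I: "finite I"
    and h: "\<And>i. i \<in> I \<Longrightarrow> continuous_on Z (h i)"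
    and pos: "\<And>z. z \<in> Z \<Longrightarrow> (\<And>i. i \<in> I \<Longrightarrow> 0 \<le> h i z) \<Longrightarrow> 0 < f z"
  obtains c lam \<delta> k where "0 \<le> c" "0 < \<delta>"
    and "\<And>z. z \<in> Z \<Longrightarrow> \<delta> \<le> f z - c * (\<Sum>i\<in>I. h i z * (1 - lam * h i z) ^ (2 * k))"
proof (cases "Z = {}")
  case True
  then show thesis using that[of 0 1] by simp
next
  case False
  have "\<exists>b. \<forall>z\<in>Z. \<bar>h i z\<bar> \<le> b" if "i \<in> I" for i
    using compact_imp_bounded[OF compact_continuous_image[OF h[OF that] Z]]
    by (auto simp: bounded_iff)
  then obtain b where b: "\<And>i z. i \<in> I \<Longrightarrow> z \<in> Z \<Longrightarrow> \<bar>h i z\<bar> \<le> b i" by metis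
  \<comment> \<open>A common bound for all \<open>\<bar>h i z\<bar>\<close>, so that
    \<open>h i z / \<gamma>\<close> lies in the range of \<open>mult_power_le\<close>; the 1 keeps
    it positive even for empty \<open>I\<close>. The witness for \<open>lam\<close> is
    \<open>1 / \<gamma>\<close>.\<close>
  define \<gamma> where "\<gamma> = 1 + (\<Sum>i\<in>I. \<bar>b i\<bar>)"
  have \<gamma>0: "\<gamma> > 0" unfolding \<gamma>_def by (intro add_pos_nonneg sum_nonneg) auto
  have \<gamma>: "\<bar>h i z\<bar> \<le> \<gamma>" if "i \<in> I" "z \<in> Z" for i z
  proof -
    have "\<bar>h i z\<bar> \<le> \<bar>b i\<bar>" using b[OF that] by simp
    also have "\<dots> \<le> (\<Sum>i\<in>I. \<bar>b i\<bar>)" using that I by (intro member_le_sum) auto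
    finally show ?thesis by (simp add: \<gamma>_def)
  qed
  define \<Phi> where "\<Phi> z = (\<Sum>i\<in>I. max 0 (- h i z))" for z
  have \<Phi>c: "continuous_on Z \<Phi>" unfolding \<Phi>_def by (intro continuous_intros h)
  have \<Phi>0: "\<Phi> z \<ge> 0" for z unfolding \<Phi>_def by (intro sum_nonneg) auto
  have \<Phi>pos: "\<Phi> z > 0" if zZ: "z \<in> Z" and fz: "f z \<le> 0" for z
  proof -
    obtain i where i: "i \<in> I" "h i z < 0" using pos[OF zZ] fz by force
    then have "0 < max 0 (- h i z)" by simp
    also have "\<dots> \<le> \<Phi> z" unfolding \<Phi>_def using i I by (intro member_le_sum) auto
    finally show ?thesis .
  qed
  have "\<exists>c\<ge>0. \<forall>z\<in>Z. 0 < f z + c * \<Phi> z"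
  proof (cases "Z \<inter> f -` {..0} = {}")
    case True
    then show ?thesis by (intro exI[of _ 0]) force
  next
    case nonempty: False
    have cl: "closed Z" using Z by (rule compact_imp_closed)
    have "compact (Z \<inter> (Z \<inter> f -` {..0}))"
      by (intro compact_Int_closed Z continuous_closed_preimage[OF f cl]) auto
    then have K: "compact (Z \<inter> f -` {..0})" by (simp add: Int_absorb1)
    obtain z0 where z0: "z0 \<in> Z" "f z0 \<le> 0" and min: "\<And>z. z \<in> Z \<Longrightarrow> f z \<le> 0 \<Longrightarrow> \<Phi> z0 \<le> \<Phi> z"
      using continuous_attains_inf[OF K nonempty continuous_on_subset[OF \<Phi>c]] by auto
    obtain z1 where z1: "\<And>z. z \<in> Z \<Longrightarrow> f z1 \<le> f z"
      using continuous_attains_inf[OF Z False f] by auto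
    \<comment> \<open>On the part of \<open>Z\<close> where \<open>f\<close> is nonpositive, \<Phi>
      has the positive minimum \<open>\<Phi> z0\<close>, and \<open>f\<close> is bounded below by
      \<open>f z1\<close>; this \<open>c\<close> lifts the sum there to at least 1.\<close>
    define c where "c = (\<bar>f z1\<bar> + 1) / \<Phi> z0"
    have p0: "\<Phi> z0 > 0" by (rule \<Phi>pos[OF z0])
    have c0: "c \<ge> 0" unfolding c_def using p0 by simp
    have "0 < f z + c * \<Phi> z" if "z \<in> Z" for z
    proof (cases "f z \<le> 0")
      case True
      have "\<bar>f z1\<bar> + 1 = c * \<Phi> z0" unfolding c_def using p0 by simp
      also have "\<dots> \<le> c * \<Phi> z" using min[OF that True] c0 by (rule mult_left_mono)
      finally show ?thesis using z1[OF that] by linarith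
    next
      case False
      then show ?thesis using c0 \<Phi>0[of z] by (intro add_pos_nonneg) auto
    qed
    then show ?thesis using c0 by blast
  qed
  then obtain c where c: "c \<ge> 0" "\<And>z. z \<in> Z \<Longrightarrow> 0 < f z + c * \<Phi> z" by blast
  have "continuous_on Z (\<lambda>z. f z + c * \<Phi> z)" by (intro continuous_intros f \<Phi>c)
  then obtain z2 where z2: "z2 \<in> Z" "\<And>z. z \<in> Z \<Longrightarrow> f z2 + c * \<Phi> z2 \<le> f z + c * \<Phi> z"
    using continuous_attains_inf[OF Z False] by blast
  define \<delta> where "\<delta> = f z2 + c * \<Phi> z2"
  have \<delta>: "\<delta> > 0" unfolding \<delta>_def using c(2) z2(1) .
  \<comment> \<open>Large enough to keep the total error
    \<open>c * real (card I) * \<gamma> / (2 * real k)\<close> below half of the minimum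
    \<open>\<delta>\<close>; the other half is the margin returned.\<close>
  obtain k :: nat where k: "c * real (card I) * \<gamma> / \<delta> < real k" using reals_Archimedean2 by blast
  have "0 \<le> c * real (card I) * \<gamma> / \<delta>" using c \<gamma>0 \<delta> by simp
  then have k0: "k > 0" using k by (cases k) auto
  have k': "c * (real (card I) * \<gamma> / (2 * real k)) \<le> \<delta> / 2"
  proof -
    have "c * real (card I) * \<gamma> \<le> real k * \<delta>" using k \<delta> by (simp add: divide_less_eq)
    then show ?thesis using k0 by (simp add: field_simps)
  qed
  have "\<delta> / 2 \<le> f z - c * (\<Sum>i\<in>I. h i z * (1 - (1 / \<gamma>) * h i z) ^ (2 * k))" if z: "z \<in> Z" for z
  proof -
    have "(\<Sum>i\<in>I. h i z * (1 - (1 / \<gamma>) * h i z) ^ (2 * k)) \<le> (\<Sum>i\<in>I. \<gamma> / (2 * real k) - max 0 (- h i z))"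
    proof (rule sum_mono)
      fix i assume i: "i \<in> I"
      have "h i z / \<gamma> * (1 - h i z / \<gamma>) ^ (2 * k) \<le> 1 / (2 * real k) - max 0 (- (h i z / \<gamma>))"
        using \<gamma>[OF i z] \<gamma>0 k0 by (intro mult_power_le) auto
      then have "\<gamma> * (h i z / \<gamma> * (1 - h i z / \<gamma>) ^ (2 * k)) \<le> \<gamma> * (1 / (2 * real k) - max 0 (- (h i z / \<gamma>)))"
        using \<gamma>0 by (intro mult_left_mono) auto
      moreover have "\<gamma> * max 0 (- (h i z / \<gamma>)) = max 0 (- h i z)"
        using \<gamma>0 by (auto simp: max_def field_simps)
      ultimately show "h i z * (1 - (1 / \<gamma>) * h i z) ^ (2 * k) \<le> \<gamma> / (2 * real k) - max 0 (- h i z)"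
        using \<gamma>0 by (simp add: right_diff_distrib)
    qed
    also have "\<dots> = real (card I) * \<gamma> / (2 * real k) - \<Phi> z"
      by (simp add: sum_subtractf \<Phi>_def)
    finally have "c * (\<Sum>i\<in>I. h i z * (1 - (1 / \<gamma>) * h i z) ^ (2 * k))
        \<le> c * (real (card I) * \<gamma> / (2 * real k) - \<Phi> z)"
      using c(1) by (rule mult_left_mono)
    also have "\<dots> \<le> \<delta> / 2 - c * \<Phi> z" using k' by (simp add: right_diff_distrib)
    finally show ?thesis using z2(2)[OF z, folded \<delta>_def] by argo
  qed
  note bound = this
  show thesis by (rule that[OF c(1) _ bound]) (use \<delta> in auto)
qed

subsection \<open>Generators and homogenization\<close>

definition hvar :: "'n option \<Rightarrow> 'n pol" where
  "hvar i = (case i of None \<Rightarrow> 1 | Some j \<Rightarrow> X j)"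

text \<open>The generators are the squares of \<open>(x\<^sub>i \<plusminus> x\<^sub>j)/2\<close> over all ordered pairs, dehomogenized. They span the
  quadratic forms, and their sum is a multiple of \<open>1 + \<Sum>X\<^sub>i\<^sup>2\<close>.\<close>

definition gen_root :: "'n option \<times> 'n option \<times> bool \<Rightarrow> 'n pol" where
  "gen_root = (\<lambda>(i, j, s). pconst (1 / 2) * (if s then hvar i + hvar j else hvar i - hvar j))"

definition gen :: "'n option \<times> 'n option \<times> bool \<Rightarrow> 'n pol" where
  "gen k = (gen_root k)\<^sup>2"

text \<open>When \<open>y\<close> consists of the squares ((x_i +- x_j)/2)^2, this is the matrix of
  the products x_i x_j. Elsewhere on the simplex it need not have rank one.\<close>

definition gram :: "real ^ ('n::finite option \<times> 'n option \<times> bool) \<Rightarrow> 'n option \<Rightarrow> 'n option \<Rightarrow> real" where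
  "gram y i j = y $ (i, j, True) - y $ (i, j, False)"

lemma half_plus_half: "pconst (1 / 2) + pconst (1 / 2) = (1 :: 'v pol)"
  by (simp flip: pconst_add)

lemma gen_diff: "gen (i, j, True) - gen (i, j, False) = hvar i * hvar j"
proof -
  have "gen (i, j, True) - gen (i, j, False)
     = (pconst (1 / 2) + pconst (1 / 2))\<^sup>2 * (hvar i * hvar j)"
    unfolding gen_def gen_root_def prod.case if_True if_False by (simp add: power2_eq_square algebra_simps)
  then show ?thesis by (simp add: half_plus_half)
qed

lemma gen_sum: "gen (i, j, True) + gen (i, j, False) = pconst (1 / 2) * ((hvar i)\<^sup>2 + (hvar j)\<^sup>2)"
proof -
  have "gen (i, j, True) + gen (i, j, False)
     = (pconst (1 / 2) + pconst (1 / 2)) * pconst (1 / 2) * ((hvar i)\<^sup>2 + (hvar j)\<^sup>2)"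
    unfolding gen_def gen_root_def prod.case if_True if_False by (simp add: power2_eq_square algebra_simps)
  then show ?thesis by (simp add: half_plus_half)
qed

lemma sum_gen_type:
  fixes f :: "'n::finite option \<times> 'n option \<times> bool \<Rightarrow> 'b::comm_monoid_add"
  shows "(\<Sum>k\<in>UNIV. f k) = (\<Sum>i\<in>UNIV. \<Sum>j\<in>UNIV. f (i, j, True) + f (i, j, False))"
proof -
  have "(\<Sum>k\<in>UNIV. f k) = (\<Sum>i\<in>UNIV. \<Sum>j\<in>UNIV. \<Sum>s\<in>UNIV. f (i, j, s))"
    unfolding UNIV_Times_UNIV[symmetric] sum.cartesian_product' ..
  then show ?thesis by (simp add: UNIV_bool add.commute)
qed

lemma sum_gen:
  "(\<Sum>k\<in>UNIV. gen k) = pconst (real (CARD('n option))) * (1 + (\<Sum>i\<in>UNIV. (X i :: 'n::finite pol)\<^sup>2))"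
proof -
  have th: "(\<Sum>i\<in>UNIV. (hvar i)\<^sup>2) = 1 + (\<Sum>i\<in>UNIV. (X i :: 'n pol)\<^sup>2)"
    by (simp add: UNIV_option_conv sum.reindex hvar_def)
  have "(\<Sum>k\<in>UNIV. gen k)
     = (\<Sum>i\<in>UNIV. \<Sum>j\<in>UNIV. pconst (1 / 2) * ((hvar i)\<^sup>2 + (hvar j :: 'n pol)\<^sup>2))"
    unfolding sum_gen_type gen_sum ..
  also have "\<dots> = (pconst (1 / 2) + pconst (1 / 2)) * (of_nat CARD('n option) * (\<Sum>i\<in>UNIV. (hvar i :: 'n pol)\<^sup>2))"
    by (simp only: sum_distrib_left[symmetric] sum.distrib sum_constant distrib_right) (simp add: distrib_left)
  finally show ?thesis unfolding half_plus_half th pconst_of_nat by simp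
qed

lemma form_gram: "form gen 1 (\<lambda>y. gram y i j) (hvar i * hvar (j :: 'n::finite option))"
  unfolding gram_def gen_diff[symmetric] by (intro form_diff form_var)

text \<open>With \<open>y\<close> replaced by \<open>gen\<close>, the last two hypotheses become identities between polynomials,
  so they can be imposed as constraints whose associated polynomial is 0.\<close>

lemma gram_rank_one:
  fixes y :: "real ^ ('n::finite option \<times> 'n option \<times> bool)"
  assumes y0: "\<And>k. 0 \<le> y $ k" and y1: "(\<Sum>k\<in>UNIV. y $ k) = 1"
    and lin: "\<And>i j. 2 * (y $ (i, j, True) + y $ (i, j, False)) = gram y i i + gram y j j"
    and quad: "\<And>i j l. gram y i j * gram y i l = gram y i i * gram y j l"
  obtains x where "x \<noteq> 0" and "\<And>i j. gram y i j = x $ i * x $ j"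
proof -
  have nn: "gram y i i \<ge> 0" for i using lin[of i i] y0[of "(i, i, True)"] y0[of "(i, i, False)"] by simp
  have "\<exists>i. gram y i i \<noteq> 0"
  proof (rule ccontr)
    assume "\<nexists>i. gram y i i \<noteq> 0"
    then have "y $ (i, j, True) + y $ (i, j, False) = 0" for i j using lin[of i j] by simp
    then show False using y1 unfolding sum_gen_type by simp
  qed
  then obtain i where i: "gram y i i > 0" using nn by (metis order_le_less)
  \<comment> \<open>Row \<open>i\<close> of a matrix x x^T, divided by the root of its diagonal
    entry, is x up to sign; \<open>quad\<close> says that this candidate does reproduce all
    entries.\<close>
  define x :: "real ^ 'n option" where "x = (\<chi> j. gram y i j / sqrt (gram y i i))"
  have "gram y j l = x $ j * x $ l" for j l
    using quad[of i j l] i by (simp add: x_def field_simps)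
  moreover have "x \<noteq> 0"
  proof
    assume "x = 0"
    then have "x $ i = 0" by simp
    then show False using i by (simp add: x_def)
  qed
  ultimately show thesis using that by blast
qed

section \<open>Monomials of even degree as forms\<close>

lemma prod_power_remove:
  fixes f :: "'i::finite \<Rightarrow> 'b::comm_semiring_1"
  assumes "\<beta> i > 0"
  shows "(\<Prod>l\<in>UNIV. f l ^ \<beta> l) = f i * (\<Prod>l\<in>UNIV. f l ^ (\<beta>(i := \<beta> i - 1)) l)"
proof -
  have "(\<Prod>l\<in>UNIV. f l ^ \<beta> l) = f i ^ \<beta> i * (\<Prod>l\<in>UNIV - {i}. f l ^ \<beta> l)"
    by (rule prod.remove) auto
  also have "f i ^ \<beta> i = f i * f i ^ (\<beta> i - 1)" using assms by (metis power_minus_mult mult.commute)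
  also have "(\<Prod>l\<in>UNIV - {i}. f l ^ \<beta> l) = (\<Prod>l\<in>UNIV - {i}. f l ^ (\<beta>(i := \<beta> i - 1)) l)"
    by (intro prod.cong) auto
  also have "f i * f i ^ (\<beta> i - 1) * \<dots> = f i * (f i ^ (\<beta>(i := \<beta> i - 1)) i * \<dots>)"
    by (simp add: mult.assoc)
  also have "f i ^ (\<beta>(i := \<beta> i - 1)) i * (\<Prod>l\<in>UNIV - {i}. f l ^ (\<beta>(i := \<beta> i - 1)) l)
      = (\<Prod>l\<in>UNIV. f l ^ (\<beta>(i := \<beta> i - 1)) l)"
    by (rule prod.remove[symmetric]) auto
  finally show ?thesis .
qed

lemma sum_remove_one:
  fixes \<beta> :: "'i::finite \<Rightarrow> nat"
  assumes "(\<Sum>l\<in>UNIV. \<beta> l) = Suc m"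
  obtains i where "\<beta> i > 0" and "(\<Sum>l\<in>UNIV. (\<beta>(i := \<beta> i - 1)) l) = m"
proof -
  obtain i where i: "\<beta> i > 0" using assms by (metis gr0I sum.neutral nat.distinct(1))
  have "(\<Sum>l\<in>UNIV. \<beta> l) = \<beta> i + (\<Sum>l\<in>UNIV - {i}. \<beta> l)" by (rule sum.remove) auto
  moreover have "(\<Sum>l\<in>UNIV. (\<beta>(i := \<beta> i - 1)) l)
     = (\<beta>(i := \<beta> i - 1)) i + (\<Sum>l\<in>UNIV - {i}. (\<beta>(i := \<beta> i - 1)) l)" by (rule sum.remove) auto
  moreover have "(\<Sum>l\<in>UNIV - {i}. (\<beta>(i := \<beta> i - 1)) l) = (\<Sum>l\<in>UNIV - {i}. \<beta> l)"
    by (intro sum.cong) auto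
  ultimately have "(\<Sum>l\<in>UNIV. (\<beta>(i := \<beta> i - 1)) l) = m" using assms i by simp
  with i that show thesis by blast
qed

text \<open>The 2r factors of the monomial are grouped into r pairs, and each product x_i x_j is
  read as \<open>gram y i j\<close>. The form depends on the grouping, but its values at
  \<open>gen\<close> and at points with rank-one \<open>gram\<close> do not.\<close>

lemma form_monomial:
  fixes \<beta> :: "'n::finite option \<Rightarrow> nat"
  assumes "(\<Sum>i\<in>UNIV. \<beta> i) = 2 * r"
  shows "\<exists>\<phi>. form gen r \<phi> (\<Prod>i\<in>UNIV. hvar i ^ \<beta> i) \<and>
    (\<forall>y x. (\<forall>i j. gram y i j = x $ i * x $ j) \<longrightarrow> \<phi> y = (\<Prod>i\<in>UNIV. x $ i ^ \<beta> i))"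
  using assms
proof (induction r arbitrary: \<beta>)
  case 0
  then show ?case using form_const[of gen 1] by auto
next
  case (Suc r)
  then have "(\<Sum>i\<in>UNIV. \<beta> i) = Suc (Suc (2 * r))" by simp
  then obtain i where i: "\<beta> i > 0" and s1: "(\<Sum>l\<in>UNIV. (\<beta>(i := \<beta> i - 1)) l) = Suc (2 * r)"
    by (rule sum_remove_one)
  define \<beta>1 where "\<beta>1 = \<beta>(i := \<beta> i - 1)"
  obtain j where j: "\<beta>1 j > 0" and s2: "(\<Sum>l\<in>UNIV. (\<beta>1(j := \<beta>1 j - 1)) l) = 2 * r"
    using s1[folded \<beta>1_def] by (rule sum_remove_one)
  define \<beta>2 where "\<beta>2 = \<beta>1(j := \<beta>1 j - 1)"
  obtain \<phi> where \<phi>: "form gen r \<phi> (\<Prod>i\<in>UNIV. hvar i ^ \<beta>2 i)"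
    "\<forall>y x. (\<forall>i j. gram y i j = x $ i * x $ j) \<longrightarrow> \<phi> y = (\<Prod>i\<in>UNIV. x $ i ^ \<beta>2 i)"
    using Suc.IH[OF s2[folded \<beta>2_def]] by blast
  have eq: "(\<Prod>l\<in>UNIV. f l ^ \<beta> l) = f i * f j * (\<Prod>l\<in>UNIV. f l ^ \<beta>2 l)" 
    for f :: "'n option \<Rightarrow> 'b::comm_semiring_1"
    unfolding prod_power_remove[of \<beta> i, OF i, folded \<beta>1_def] prod_power_remove[of \<beta>1 j, OF j, folded \<beta>2_def]
    by (rule mult.assoc[symmetric])
  have "form gen (1 + r) (\<lambda>y. gram y i j * \<phi> y) (hvar i * hvar j * (\<Prod>i\<in>UNIV. hvar i ^ \<beta>2 i))"
    by (intro form_mult form_gram \<phi>(1))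
  then show ?case
    using \<phi>(2) by (intro exI[of _ "\<lambda>y. gram y i j * \<phi> y"]) (simp add: eq)
qed

section \<open>Homogenization and evaluation\<close>

lemma lookup_homog_exp_None: "Poly_Mapping.lookup (homog_exp d \<alpha>) None = d - exp_deg \<alpha>"
  by (simp add: homog_exp_def lookup_add lookup_sum lookup_single)

lemma lookup_homog_exp_Some: "Poly_Mapping.lookup (homog_exp d \<alpha>) (Some i) = Poly_Mapping.lookup \<alpha> i"
  by (simp add: homog_exp_def lookup_add lookup_sum lookup_single when_def)

lemma pol_eq_sum_single: "p = (\<Sum>\<alpha>\<in>Poly_Mapping.keys p. Poly_Mapping.single \<alpha> (Poly_Mapping.lookup p \<alpha>))"
  by (rule poly_mapping_eqI) (simp add: lookup_sum lookup_single when_def in_keys_iff)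

lemma X_power: "X i ^ m = Poly_Mapping.single (Poly_Mapping.single i m) 1"
proof (induction m)
  case (Suc m)
  then show ?case by (simp add: X_def mult_single flip: single_add)
qed simp

lemma prod_single: "finite I \<Longrightarrow> (\<Prod>i\<in>I. Poly_Mapping.single (f i) (1::real)) = Poly_Mapping.single (\<Sum>i\<in>I. f i) 1"
  by (induction I rule: finite_induct) (simp_all add: mult_single)

lemma prod_hvar_homog_exp:
  fixes \<alpha> :: "'n::finite \<Rightarrow>\<^sub>0 nat"
  shows "(\<Prod>i\<in>UNIV. hvar i ^ Poly_Mapping.lookup (homog_exp d \<alpha>) i) = Poly_Mapping.single \<alpha> 1"
proof -
  have "(\<Sum>i\<in>UNIV. Poly_Mapping.single i (Poly_Mapping.lookup \<alpha> i)) = \<alpha>"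
    by (rule poly_mapping_eqI) (simp add: lookup_sum lookup_single when_def)
  then have "(\<Prod>i\<in>UNIV. X i ^ Poly_Mapping.lookup \<alpha> i) = Poly_Mapping.single \<alpha> 1"
    by (simp add: X_power prod_single)
  then show ?thesis
    by (simp add: UNIV_option_conv prod.reindex hvar_def lookup_homog_exp_Some)
qed

lemma sum_homog_exp:
  "exp_deg \<alpha> \<le> d \<Longrightarrow> (\<Sum>i\<in>UNIV. Poly_Mapping.lookup (homog_exp d \<alpha>) i) = d"
  by (simp add: UNIV_option_conv sum.reindex lookup_homog_exp_Some lookup_homog_exp_None)
    (simp add: exp_deg_def)

lemma eval_pol_superset:
  assumes "finite S" and "Poly_Mapping.keys p \<subseteq> S"
  shows "eval_pol x p = (\<Sum>\<alpha>\<in>S. Poly_Mapping.lookup p \<alpha> * (\<Prod>i\<in>UNIV. x $ i ^ Poly_Mapping.lookup \<alpha> i))"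
  unfolding eval_pol_def using assms by (intro sum.mono_neutral_left) (auto simp: in_keys_iff)

lemma eval_pol_add: "eval_pol x (p + q) = eval_pol x p + eval_pol x q"
proof -
  let ?S = "Poly_Mapping.keys p \<union> Poly_Mapping.keys q"
  show ?thesis
    using Poly_Mapping.keys_add[of p q]
    by (subst (1 2 3) eval_pol_superset[of ?S])
      (auto simp: lookup_add distrib_right sum.distrib)
qed

lemma eval_pol_sum: "eval_pol x (\<Sum>i\<in>I. f i) = (\<Sum>i\<in>I. eval_pol x (f i))"
proof -
  have "eval_pol x 0 = 0" by (simp add: eval_pol_def)
  then show ?thesis by (induction I rule: infinite_finite_induct) (auto simp: eval_pol_add)
qed

lemma eval_pol_single:
  "eval_pol x (Poly_Mapping.single \<alpha> c) = c * (\<Prod>i\<in>UNIV. x $ i ^ Poly_Mapping.lookup \<alpha> i)"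
  by (subst eval_pol_superset[of "{\<alpha>}"]) auto

lemma exp_deg_le_pol_deg: "\<alpha> \<in> Poly_Mapping.keys p \<Longrightarrow> exp_deg \<alpha> \<le> pol_deg p"
  unfolding pol_deg_def by (intro Max_ge) auto

lemma pol_deg_le_mat_deg: "pol_deg (A $ i $ j) \<le> mat_deg A"
  unfolding mat_deg_def by (intro Max_ge) (auto intro!: rev_image_eqI[of "(i, j)"])

text \<open>One form ties the affine and the homogeneous side together: at \<open>gen\<close>, where
  X_0 is 1, it gives \<open>p\<close> itself, and at points with rank-one \<open>gram\<close> it
  gives the homogenization. The degree is only bounded above, since the entries of a matrix are
  homogenized to a common degree.\<close>

lemma form_homog:
  fixes p :: "'n::finite pol"
  assumes "pol_deg p \<le> 2 * r"
  shows "\<exists>\<phi>. form gen r \<phi> p \<and>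
    (\<forall>y x. (\<forall>i j. gram y i j = x $ i * x $ j) \<longrightarrow> \<phi> y = eval_pol x (homog_pol (2 * r) p))"
proof -
  let ?m = "\<lambda>\<alpha>. (\<Prod>i\<in>UNIV. hvar i ^ Poly_Mapping.lookup (homog_exp (2 * r) \<alpha>) i) :: 'n pol"
  have "\<forall>\<alpha>\<in>Poly_Mapping.keys p. \<exists>\<phi>. form gen r \<phi> (?m \<alpha>) \<and>
    (\<forall>y x. (\<forall>i j. gram y i j = x $ i * x $ j) \<longrightarrow> \<phi> y = (\<Prod>i\<in>UNIV. x $ i ^ Poly_Mapping.lookup (homog_exp (2 * r) \<alpha>) i))"
    using assms exp_deg_le_pol_deg by (intro ballI form_monomial sum_homog_exp) force
  then obtain \<phi> where \<phi>: "\<And>\<alpha>. \<alpha> \<in> Poly_Mapping.keys p \<Longrightarrow> form gen r (\<phi> \<alpha>) (?m \<alpha>)"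
    and \<phi>': "\<And>\<alpha> y x. \<alpha> \<in> Poly_Mapping.keys p \<Longrightarrow> (\<forall>i j. gram y i j = x $ i * x $ j) \<Longrightarrow>
      \<phi> \<alpha> y = (\<Prod>i\<in>UNIV. x $ i ^ Poly_Mapping.lookup (homog_exp (2 * r) \<alpha>) i)"
    unfolding bchoice_iff by blast
  have "form gen r (\<lambda>y. \<Sum>\<alpha>\<in>Poly_Mapping.keys p. Poly_Mapping.lookup p \<alpha> * \<phi> \<alpha> y)
      (\<Sum>\<alpha>\<in>Poly_Mapping.keys p. pconst (Poly_Mapping.lookup p \<alpha>) * ?m \<alpha>)"
    by (intro form_sum form_scale \<phi>)
  also have "(\<Sum>\<alpha>\<in>Poly_Mapping.keys p. pconst (Poly_Mapping.lookup p \<alpha>) * ?m \<alpha>) = p"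
    unfolding prod_hvar_homog_exp
    by (subst (4) pol_eq_sum_single) (simp add: pconst_def mult_single)
  finally have "form gen r (\<lambda>y. \<Sum>\<alpha>\<in>Poly_Mapping.keys p. Poly_Mapping.lookup p \<alpha> * \<phi> \<alpha> y) p" .
  moreover have "(\<Sum>\<alpha>\<in>Poly_Mapping.keys p. Poly_Mapping.lookup p \<alpha> * \<phi> \<alpha> y) = eval_pol x (homog_pol (2 * r) p)"
    if "\<forall>i j. gram y i j = x $ i * x $ j" for y x
    unfolding homog_pol_def eval_pol_sum eval_pol_single using \<phi>'[OF _ that] by simp
  ultimately show ?thesis by blast
qed

subsection \<open>Scalar constraints of full degree\<close>

text \<open>Polarization: a form vanishing at e_i, e_j and e_i + e_j has C_ij + C_ji = 2 C_ij =
  0.\<close>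

lemma sym_quadratic_form_nonzero:
  fixes C :: "real ^ 't::finite ^ 't"
  assumes sym: "\<And>i j. C $ i $ j = C $ j $ i" and "C \<noteq> 0"
  obtains u where "u \<bullet> (C *v u) \<noteq> 0"
proof -
  have e: "axis i 1 \<bullet> (C *v axis j 1) = C $ i $ j" for i j
    by (simp add: matrix_vector_mul_component inner_axis inner_axis')
  have "C = 0" if z: "\<And>u. u \<bullet> (C *v u) = 0"
  proof -
    have "C $ i $ j = 0" for i j
      using z[of "axis i 1 + axis j 1"] z[of "axis i 1"] z[of "axis j 1"] sym[of i j]
      by (simp add: matrix_vector_right_distrib inner_add_left inner_add_right e)
    then show ?thesis by (simp add: vec_eq_iff)
  qed
  then show thesis using assms(2) that by blast
qed

text \<open>A quadratic form vanishing on a nonempty open set has zero second differences there.\<close>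

lemma perturb_negative_direction:
  fixes A C :: "real ^ 't::finite ^ 't"
  assumes neg: "v \<bullet> (A *v v) < 0" and u: "u \<bullet> (C *v u) \<noteq> 0"
  obtains v' where "v' \<bullet> (A *v v') < 0" and "v' \<bullet> (C *v v') \<noteq> 0"
proof -
  define q where "q s = (v + s *\<^sub>R u) \<bullet> (A *v (v + s *\<^sub>R u))" for s
  have q_eq: "(w \<bullet> (B *v w)) = v \<bullet> (B *v v) + s * (v \<bullet> (B *v u) + u \<bullet> (B *v v)) + s\<^sup>2 * (u \<bullet> (B *v u))"
    if "w = v + s *\<^sub>R u" for w s and B :: "real ^ 't ^ 't"
    unfolding that
    by (simp add: matrix_vector_right_distrib matrix_vector_mult_scaleR inner_add_left
        inner_add_right power2_eq_square algebra_simps)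
  have "(q \<longlongrightarrow> q 0) (at 0)"
    unfolding q_def q_eq[OF refl] by (auto intro!: tendsto_eq_intros)
  moreover have "q 0 < 0" using neg by (simp add: q_def)
  ultimately have "eventually (\<lambda>s. q s < 0) (at 0)" by (rule order_tendstoD(2))
  then obtain d where d: "d > 0" "\<And>s. s \<noteq> 0 \<Longrightarrow> \<bar>s\<bar> < d \<Longrightarrow> q s < 0"
    unfolding eventually_at by (auto simp: dist_real_def)
  define s where "s = d / 2"
  have s: "s \<noteq> 0" "q s < 0" "q (- s) < 0" using d by (auto simp: s_def)
  have "\<exists>v'\<in>{v, v + s *\<^sub>R u, v + (- s) *\<^sub>R u}. v' \<bullet> (C *v v') \<noteq> 0"
  proof (rule ccontr)
    assume "\<not> ?thesis"
    then have "v \<bullet> (C *v v) = 0" "(v + s *\<^sub>R u) \<bullet> (C *v (v + s *\<^sub>R u)) = 0"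
      "(v + (- s) *\<^sub>R u) \<bullet> (C *v (v + (- s) *\<^sub>R u)) = 0" by blast+
    then have "s\<^sup>2 * (u \<bullet> (C *v u)) = 0"
      unfolding q_eq[OF refl, of s C] q_eq[OF refl, of "- s" C] by simp
    then show False using u s(1) by simp
  qed
  then show thesis using that neg s(2,3) unfolding q_def by blast
qed

lemma lookup_quad_pol:
  "Poly_Mapping.lookup (quad_pol v H) \<alpha> = v \<bullet> ((\<chi> i j. Poly_Mapping.lookup (H $ i $ j) \<alpha>) *v v)"
  unfolding mat_quadratic_form quad_pol_def by (simp add: lookup_sum lookup_pconst_mult)

lemma pol_deg_quad_pol_le: "pol_deg (quad_pol v H) \<le> mat_deg H"
proof -
  have "exp_deg \<alpha> \<le> mat_deg H" if "\<alpha> \<in> Poly_Mapping.keys (quad_pol v H)" for \<alpha>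
  proof -
    have "(\<chi> i j. Poly_Mapping.lookup (H $ i $ j) \<alpha>) \<noteq> 0"
      using that unfolding in_keys_iff lookup_quad_pol by auto
    then obtain i j where "\<alpha> \<in> Poly_Mapping.keys (H $ i $ j)"
      by (auto simp: vec_eq_iff in_keys_iff)
    then show ?thesis using exp_deg_le_pol_deg pol_deg_le_mat_deg order_trans by metis
  qed
  then show ?thesis unfolding pol_deg_def by auto
qed

lemma mat_deg_attained:
  assumes "mat_deg H \<noteq> 0"
  obtains i j \<alpha> where "\<alpha> \<in> Poly_Mapping.keys (H $ i $ j)" and "exp_deg \<alpha> = mat_deg H"
proof -
  have "mat_deg H \<in> range (\<lambda>(i, j). pol_deg (H $ i $ j))"
    unfolding mat_deg_def by (intro Max_in) auto
  then obtain i j where ij: "mat_deg H = pol_deg (H $ i $ j)" by auto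
  have "pol_deg (H $ i $ j) \<in> insert 0 (exp_deg ` Poly_Mapping.keys (H $ i $ j))"
    unfolding pol_deg_def by (intro Max_in) auto
  then show thesis using that ij assms by auto
qed

text \<open>Top-degree terms may cancel in v^T H v. The coefficient matrix \<open>C\<close> of a top
  monomial is symmetric and nonzero, so a small change of \<open>v\<close> makes v^T C v nonzero and
  keeps the strict inequality. Full degree is what makes the degrees of the scalar constraints
  even.\<close>

lemma negative_direction_full_degree:
  fixes H :: "('v::finite, 't::finite) pol_mat"
  assumes sym: "sym_mat H" and neg: "v \<bullet> (A *v v) < 0"
  obtains v' where "v' \<bullet> (A *v v') < 0" and "pol_deg (quad_pol v' H) = mat_deg H"
proof (cases "mat_deg H = 0")
  case True
  then show thesis using that[OF neg] pol_deg_quad_pol_le[of v H] by simp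
next
  case False
  obtain i j \<alpha> where \<alpha>: "\<alpha> \<in> Poly_Mapping.keys (H $ i $ j)" "exp_deg \<alpha> = mat_deg H"
    using mat_deg_attained[OF False] by blast
  define C :: "real ^ 't ^ 't" where "C = (\<chi> i j. Poly_Mapping.lookup (H $ i $ j) \<alpha>)"
  have "H $ i $ j = H $ j $ i" for i j
    using sym unfolding sym_mat_def by (metis (no_types, lifting) transpose_def vec_lambda_beta)
  then have "C $ i $ j = C $ j $ i" for i j by (simp add: C_def)
  moreover have "C \<noteq> 0" using \<alpha>(1) by (auto simp: C_def vec_eq_iff in_keys_iff)
  ultimately obtain u where "u \<bullet> (C *v u) \<noteq> 0" by (rule sym_quadratic_form_nonzero)
  then obtain v' where v': "v' \<bullet> (A *v v') < 0" "v' \<bullet> (C *v v') \<noteq> 0"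
    using perturb_negative_direction[OF neg] by blast
  then have "\<alpha> \<in> Poly_Mapping.keys (quad_pol v' H)"
    unfolding in_keys_iff lookup_quad_pol C_def by simp
  then have "mat_deg H \<le> pol_deg (quad_pol v' H)" using exp_deg_le_pol_deg \<alpha>(2) by metis
  then show thesis using that[OF v'(1)] pol_deg_quad_pol_le[of v' H] by simp
qed

lemma form_homog_mat:
  fixes H :: "('n::finite, 't::finite) pol_mat"
  assumes "mat_deg H = 2 * r" and sym: "sym_mat H"
  obtains \<phi> where "\<And>i j. form gen r (\<phi> i j) (H $ i $ j)" and "\<And>i j. \<phi> i j = \<phi> j i"
    and "\<And>i j y x. (\<And>i j. gram y i j = x $ i * x $ j) \<Longrightarrow> \<phi> i j y = eval_mat x (homog_mat H) $ i $ j"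
proof -
  have symH: "H $ i $ j = H $ j $ i" for i j
    using sym unfolding sym_mat_def by (metis (no_types, lifting) transpose_def vec_lambda_beta)
  define Q where "Q p \<phi> \<longleftrightarrow> form gen r \<phi> p \<and>
    (\<forall>y x. (\<forall>i j. gram y i j = x $ i * x $ j) \<longrightarrow> \<phi> y = eval_pol x (homog_pol (2 * r) p))"
    for p :: "'n pol" and \<phi>
  \<comment> \<open>The form is chosen as a function of the polynomial, not of the index pair, so
    that the equal entries (i, j) and (j, i) receive the same form.\<close>
  have "\<forall>p. \<exists>\<phi>. pol_deg p \<le> 2 * r \<longrightarrow> Q p \<phi>"
    unfolding Q_def using form_homog by blast
  then obtain \<Phi> where \<Phi>: "\<And>p. pol_deg p \<le> 2 * r \<Longrightarrow> Q p (\<Phi> p)" by metis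
  have Q: "Q (H $ i $ j) (\<Phi> (H $ i $ j))" for i j
    by (rule \<Phi>) (use pol_deg_le_mat_deg[of H i j] assms(1) in simp)
  show thesis
  proof (rule that[of "\<lambda>i j. \<Phi> (H $ i $ j)"])
    show "form gen r (\<Phi> (H $ i $ j)) (H $ i $ j)" for i j using Q unfolding Q_def by blast
    show "\<Phi> (H $ i $ j) = \<Phi> (H $ j $ i)" for i j using symH by simp
    show "\<Phi> (H $ i $ j) y = eval_mat x (homog_mat H) $ i $ j"
      if "\<And>i j. gram y i j = x $ i * x $ j" for i j y x
      using Q[of i j] that unfolding Q_def by (simp add: eval_mat_def homog_mat_def map_matrix_def assms(1))
  qed
qed

lemma form_quad_pol:
  fixes H :: "('n::finite, 't::finite) pol_mat"
  assumes "mat_deg H = 2 * r" and "sym_mat H"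
  obtains h where "form gen r h (quad_pol v H)"
    and "\<And>y x. (\<And>i j. gram y i j = x $ i * x $ j) \<Longrightarrow> h y = v \<bullet> (eval_mat x (homog_mat H) *v v)"
proof -
  obtain \<phi> where \<phi>: "\<And>i j. form gen r (\<phi> i j) (H $ i $ j)"
    "\<And>i j y x. (\<And>i j. gram y i j = x $ i * x $ j) \<Longrightarrow> \<phi> i j y = eval_mat x (homog_mat H) $ i $ j"
    using form_homog_mat[OF assms] by metis
  show thesis
  proof (rule that[of "\<lambda>y. \<Sum>i\<in>UNIV. \<Sum>j\<in>UNIV. v $ i * v $ j * \<phi> i j y"])
    show "form gen r (\<lambda>y. \<Sum>i\<in>UNIV. \<Sum>j\<in>UNIV. v $ i * v $ j * \<phi> i j y) (quad_pol v H)"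
      unfolding quad_pol_def by (intro form_sum form_scale \<phi>(1))
    show "(\<Sum>i\<in>UNIV. \<Sum>j\<in>UNIV. v $ i * v $ j * \<phi> i j y) = v \<bullet> (eval_mat x (homog_mat H) *v v)"
      if "\<And>i j. gram y i j = x $ i * x $ j" for y x
      unfolding mat_quadratic_form using \<phi>(2)[OF that] by simp
  qed
qed

subsection \<open>Assembling the representation\<close>

text \<open>The pool from which \<open>G\<close> is drawn; the degree condition passes the even
  degrees in \<open>\<G>\<close> on to the scalar polynomials.\<close>

definition full_quads :: "('n::finite, 't::finite) pol_mat set \<Rightarrow> 'n pol set" where
  "full_quads \<G> = {quad_pol v H | v H. H \<in> \<G> \<and> pol_deg (quad_pol v H) = mat_deg H}"

lemma compact_std_simplex: "compact {y :: real ^ 'k::finite. (\<forall>k. 0 \<le> y $ k) \<and> (\<Sum>k\<in>UNIV. y $ k) = 1}"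
  (is "compact ?D")
proof -
  have "closed ?D"
    unfolding Collect_conj_eq Collect_all_eq
    by (intro closed_Int closed_INT ballI closed_Collect_le closed_Collect_eq continuous_intros)
  moreover have "?D \<subseteq> cball 0 1"
  proof
    fix y assume y: "y \<in> ?D"
    have "norm y \<le> (\<Sum>k\<in>UNIV. \<bar>y $ k\<bar>)" by (rule norm_le_l1_cart)
    also have "\<dots> = 1" using y by simp
    finally show "y \<in> cball 0 1" by simp
  qed
  ultimately show ?thesis
    using bounded_subset[OF bounded_cball] compact_eq_bounded_closed by blast
qed

text \<open>Suppose that no constraint is negative at \<open>y\<close>. Those with polynomial 0 make
  \<open>y\<close> come from a point x by \<open>gram_rank_one\<close>; those from
  \<open>full_quads\<close> then put x into the positivity set of the homogenized matrices, where
  the homogenization of \<open>F\<close> is positive definite, against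
  \<open>nonpos\<close>.\<close>

lemma violated_constraint:
  fixes \<G> :: "('n::finite, 't::finite) pol_mat set" and F :: "('n, 't) pol_mat"
  assumes \<G>: "\<forall>A\<in>\<G>. sym_mat A \<and> even (mat_deg A)"
    and pos: "\<forall>x \<in> K_set (homog_mat ` \<G>) - {0}. pd_mat (eval_mat x (homog_mat F))"
    and y0: "\<And>k. 0 \<le> y $ k" and y1: "(\<Sum>k\<in>UNIV. y $ k) = 1"
    and v: "v \<noteq> 0" and \<phi>: "\<And>i j x. (\<And>i j. gram y i j = x $ i * x $ j) \<Longrightarrow> p $ i $ j = eval_mat x (homog_mat F) $ i $ j"
    and nonpos: "v \<bullet> (p *v v) \<le> 0"
  obtains r h g where "form gen r h g" and "g = 0 \<or> g \<in> full_quads \<G>" and "h y < 0"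
proof (rule ccontr)
  assume "\<not> thesis"
  then have nn: "h y \<ge> 0" if "form gen r h g" "g = 0 \<or> g \<in> full_quads \<G>" for r h g
    using that \<open>\<And>r h g. _ \<Longrightarrow> _ \<Longrightarrow> _ \<Longrightarrow> thesis\<close> by force
  \<comment> \<open>Both differences of \<open>h\<close> and \<open>h'\<close> are forms with
    polynomial \<open>g - g = 0\<close>, hence both are nonnegative at \<open>y\<close>. A form with
    polynomial 0 need not vanish identically, as the generators satisfy relations.\<close>
  have zero: "h y = h' y" if h: "form gen r h g" "form gen r h' g" for r h h' g
    using nn[OF form_diff[OF h]] nn[OF form_diff[OF h(2,1)]] by simp
  have lin: "2 * (y $ (i, j, True) + y $ (i, j, False)) = gram y i i + gram y j j" for i j
  proof -
    have "form gen 1 (\<lambda>y. 2 * (y $ (i, j, True) + y $ (i, j, False)))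
        (pconst 2 * (gen (i, j, True) + gen (i, j, False)))"
      by (intro form_scale form_add form_var)
    also have "pconst 2 * (gen (i, j, True) + gen (i, j, False)) = hvar i * hvar i + hvar j * hvar j"
    proof -
      have "pconst 2 * pconst (1 / 2) = (1 :: 'n pol)" by (simp flip: pconst_mult)
      then show ?thesis unfolding gen_sum mult.assoc[symmetric] by (simp add: power2_eq_square)
    qed
    finally show ?thesis
      using zero[of 1 _ _ "\<lambda>y. gram y i i + gram y j j"] form_add[OF form_gram form_gram] by blast
  qed
  have quad: "gram y i j * gram y i l = gram y i i * gram y j l" for i j l
  proof (rule zero)
    show "form gen (1 + 1) (\<lambda>y. gram y i j * gram y i l) ((hvar i * hvar j) * (hvar i * hvar l))"
      by (intro form_mult form_gram)
    have "form gen (1 + 1) (\<lambda>y. gram y i i * gram y j l) ((hvar i * hvar i) * (hvar j * hvar l))"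
      by (intro form_mult form_gram)
    then show "form gen (1 + 1) (\<lambda>y. gram y i i * gram y j l) ((hvar i * hvar j) * (hvar i * hvar l))"
      by (simp add: mult_ac)
  qed
  obtain x where x: "x \<noteq> 0" "\<And>i j. gram y i j = x $ i * x $ j"
    using gram_rank_one[OF y0 y1 lin quad] by blast
  have "psd_mat (eval_mat x (homog_mat H))" if H: "H \<in> \<G>" for H
  proof (rule ccontr)
    assume npsd: "\<not> psd_mat (eval_mat x (homog_mat H))"
    obtain r where r: "mat_deg H = 2 * r" and symH: "sym_mat H" using \<G> H by (auto elim: evenE)
    have "sym_mat (eval_mat x (homog_mat H))"
      using symH unfolding sym_mat_def eval_mat_def homog_mat_def map_matrix_def
      by (simp add: transpose_def vec_eq_iff)
    then obtain w where w: "w \<bullet> (eval_mat x (homog_mat H) *v w) < 0"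
      using npsd unfolding psd_mat_def by (auto simp: not_le)
    then obtain w' where w': "w' \<bullet> (eval_mat x (homog_mat H) *v w') < 0"
      and deg: "pol_deg (quad_pol w' H) = mat_deg H"
      using negative_direction_full_degree[OF symH] by blast
    obtain h where "form gen r h (quad_pol w' H)" "h y = w' \<bullet> (eval_mat x (homog_mat H) *v w')"
      using form_quad_pol[OF r symH] x(2) by metis
    moreover have "quad_pol w' H \<in> full_quads \<G>" unfolding full_quads_def using H deg by blast
    ultimately show False using nn w' by fastforce
  qed
  then have "x \<in> K_set (homog_mat ` \<G>) - {0}" using x(1) by (simp add: K_set_def)
  then have "pd_mat (eval_mat x (homog_mat F))" using pos by blast
  moreover have "p = eval_mat x (homog_mat F)" using \<phi>[OF x(2)] by (simp add: vec_eq_iff)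
  ultimately show False using v nonpos unfolding pd_mat_def by force
qed

text \<open>A unit vector as second coordinate turns definiteness into positivity of one function on
  a compact set. By \<open>violated_constraint\<close> the open sets where some \<open>h\<close> is
  negative cover the part where this function is nonpositive. A finite subcover feeds
  \<open>absorb_constraints\<close>, and homogeneity in \<open>v\<close> removes the
  normalization.\<close>

lemma finite_constraints:
  fixes \<G> :: "('n::finite, 't::finite) pol_mat set" and F :: "('n, 't) pol_mat"
  assumes \<G>: "\<forall>A\<in>\<G>. sym_mat A \<and> even (mat_deg A)"
    and pos: "\<forall>x \<in> K_set (homog_mat ` \<G>) - {0}. pd_mat (eval_mat x (homog_mat F))"
    and \<phi>c: "\<And>i j A. continuous_on A (\<lambda>y. p y $ i $ j)"
    and \<phi>: "\<And>i j x y. (\<And>i j. gram y i j = x $ i * x $ j) \<Longrightarrow> p y $ i $ j = eval_mat x (homog_mat F) $ i $ j"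
  obtains I c lam \<delta> k where "finite I" "0 \<le> c" "0 < \<delta>"
    and "\<And>r h g. (r, h, g) \<in> I \<Longrightarrow> form gen r h g \<and> (g = 0 \<or> g \<in> full_quads \<G>)"
    and "\<And>y v. (\<And>k. 0 \<le> y $ k) \<Longrightarrow> (\<Sum>k\<in>UNIV. y $ k) = 1 \<Longrightarrow>
      \<delta> * (norm v)\<^sup>2 \<le> v \<bullet> (p y *v v) - c * (\<Sum>(r, h, g)\<in>I. h y * (1 - lam * h y) ^ (2 * k)) * (norm v)\<^sup>2"
proof -
  define \<Delta> where "\<Delta> = {y :: real ^ ('n option \<times> 'n option \<times> bool). (\<forall>k. 0 \<le> y $ k) \<and> (\<Sum>k\<in>UNIV. y $ k) = 1}"
  define Z where "Z = \<Delta> \<times> sphere (0 :: real ^ 't) 1"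
  define f where "f z = snd z \<bullet> (p (fst z) *v snd z)" for z
  have Zc: "compact Z" unfolding Z_def \<Delta>_def by (intro compact_Times compact_std_simplex compact_sphere)
  have fc: "continuous_on Z f"
    unfolding f_def mat_quadratic_form
    by (intro continuous_intros continuous_on_compose2[OF \<phi>c[of UNIV]]) auto
  define C where "C = {(r, h, g). form gen r h g \<and> (g = 0 \<or> g \<in> full_quads \<G>)}"
  have hc: "continuous_on A (\<lambda>z. fst (snd c) (fst z))" if cC: "c \<in> C"
    for c and A :: "((real ^ ('n option \<times> 'n option \<times> bool)) \<times> (real ^ 't)) set"
  proof -
    obtain r h g where rhg: "c = (r, h, g)" "form gen r h g" using cC unfolding C_def by blast
    have "continuous_on A (\<lambda>z. h (fst z))"
      by (intro continuous_on_compose2[OF form_continuous[OF rhg(2), of UNIV]] continuous_intros) auto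
    then show ?thesis by (simp add: rhg(1))
  qed
  let ?U = "\<lambda>c. {z :: (real ^ ('n option \<times> 'n option \<times> bool)) \<times> (real ^ 't). fst (snd c) (fst z) < 0}"
  have Uo: "open (?U c)" if "c \<in> C" for c
    by (intro open_Collect_less hc that continuous_intros)
  have cl: "closed Z" using Zc by (rule compact_imp_closed)
  have "compact (Z \<inter> (Z \<inter> f -` {..0}))"
    by (intro compact_Int_closed Zc continuous_closed_preimage[OF fc cl]) auto
  then have K: "compact (Z \<inter> f -` {..0})" by (simp add: Int_absorb1)
  have cover: "Z \<inter> f -` {..0} \<subseteq> (\<Union>c\<in>C. ?U c)"
  proof
    fix z assume z: "z \<in> Z \<inter> f -` {..0}"
    have z0: "\<And>k. 0 \<le> fst z $ k" and z1: "(\<Sum>k\<in>UNIV. fst z $ k) = 1" and v: "snd z \<noteq> 0"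
      and np: "snd z \<bullet> (p (fst z) *v snd z) \<le> 0"
      using z by (auto simp: Z_def \<Delta>_def f_def)
    obtain r h g where "form gen r h g" "g = 0 \<or> g \<in> full_quads \<G>" "h (fst z) < 0"
      by (rule violated_constraint[OF \<G> pos z0 z1 v \<phi> np])
    then show "z \<in> (\<Union>c\<in>C. ?U c)" by (auto simp: C_def)
  qed
  obtain I where I: "I \<subseteq> C" "finite I" and cov: "Z \<inter> f -` {..0} \<subseteq> (\<Union>c\<in>I. ?U c)"
    by (rule compactE_image[OF K Uo cover]) auto
  have p: "0 < f z" if z: "z \<in> Z" and nn: "\<And>c. c \<in> I \<Longrightarrow> 0 \<le> fst (snd c) (fst z)" for z
  proof (rule ccontr)
    assume "\<not> 0 < f z"
    then have "z \<in> (\<Union>c\<in>I. ?U c)" using z cov by auto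
    then show False using nn by force
  qed
  obtain c lam \<delta> k where c: "0 \<le> c" "0 < \<delta>" and bound: "\<And>z. z \<in> Z \<Longrightarrow>
      \<delta> \<le> f z - c * (\<Sum>i\<in>I. fst (snd i) (fst z) * (1 - lam * fst (snd i) (fst z)) ^ (2 * k))"
  proof (rule absorb_constraints[OF Zc fc I(2), of "\<lambda>c z. fst (snd c) (fst z)"])
    show "continuous_on Z (\<lambda>z. fst (snd i) (fst z))" if "i \<in> I" for i
      using hc I(1) that by blast
  qed (use p in blast)+
  show thesis
  proof (rule that[OF I(2) c])
    show "form gen r h g \<and> (g = 0 \<or> g \<in> full_quads \<G>)" if "(r, h, g) \<in> I" for r h g
      using that I(1) by (auto simp: C_def)
    fix y :: "real ^ ('n option \<times> 'n option \<times> bool)" and v :: "real ^ 't"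
    assume y: "\<And>k. 0 \<le> y $ k" "(\<Sum>k\<in>UNIV. y $ k) = 1"
    let ?s = "\<Sum>(r, h, g)\<in>I. h y * (1 - lam * h y) ^ (2 * k)"
    show "\<delta> * (norm v)\<^sup>2 \<le> v \<bullet> (p y *v v) - c * ?s * (norm v)\<^sup>2"
    proof (cases "v = 0")
      case False
      define u where "u = (1 / norm v) *\<^sub>R v"
      have v: "v = norm v *\<^sub>R u" using False by (simp add: u_def)
      have "(y, u) \<in> Z" using y False by (simp add: Z_def \<Delta>_def u_def)
      from bound[OF this] have "\<delta> \<le> u \<bullet> (p y *v u) - c * ?s"
        by (simp add: f_def split_beta)
      then have "\<delta> * (norm v)\<^sup>2 \<le> (u \<bullet> (p y *v u) - c * ?s) * (norm v)\<^sup>2"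
        by (rule mult_right_mono) simp
      also have "\<dots> = (norm v)\<^sup>2 * (u \<bullet> (p y *v u)) - c * ?s * (norm v)\<^sup>2"
        by (simp add: left_diff_distrib)
      also have "(norm v)\<^sup>2 * (u \<bullet> (p y *v u)) = v \<bullet> (p y *v v)"
      proof -
        have "(norm v *\<^sub>R u) \<bullet> (p y *v (norm v *\<^sub>R u)) = (norm v)\<^sup>2 * (u \<bullet> (p y *v u))"
          by (simp add: matrix_vector_mult_scaleR power2_eq_square)
        then show ?thesis unfolding v[symmetric] by simp
      qed
      finally show ?thesis .
    qed simp
  qed
qed

section \<open>Membership in the power of a quadratic module\<close>

lemma psd_mat_power:
  fixes B :: "real ^ 't::finite ^ 't"
  assumes "psd_mat B" and "\<sigma> \<in> sos"
  shows "(\<chi> i j. \<sigma> * pconst (B $ i $ j)) \<in> (mat_power (qmod_pol G) :: ('v, 't) pol_mat set)"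
  unfolding mat_power_nsums
  using psd_sum_outer[OF assms(1)]
proof (induction B rule: nsums_induct)
  case zero
  have "(\<chi> i j. \<sigma> * pconst ((0 :: real ^ 't ^ 't) $ i $ j)) = (0 :: ('v, 't) pol_mat)" by (simp add: vec_eq_iff)
  then show ?case by (simp add: nsums_zero)
next
  case (add B s)
  from add.hyps obtain v where s: "s = outer v" by blast
  \<comment> \<open>The factor has to be square, so all CARD('t) rows are equal copies of
    \<open>v\<close>; the scaling makes their outer products add up to
    \<open>outer v\<close>.\<close>
  define A :: "('v, 't) pol_mat" where "A = (\<chi> i j. pconst (v $ j / sqrt (real CARD('t))))"
  have card: "real CARD('t) > 0" by simp
  have AA: "transpose A ** A = (\<chi> i j. pconst (s $ i $ j))"
  proof -
    have "(transpose A ** A) $ i $ j = pconst (s $ i $ j)" for i j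
    proof -
      have "(transpose A ** A) $ i $ j
          = pconst (real CARD('t)) * (pconst (v $ i / sqrt (real CARD('t))) * pconst (v $ j / sqrt (real CARD('t))))"
        by (simp add: matrix_matrix_mult_def transpose_def A_def pconst_of_nat)
      also have "\<dots> = pconst (real CARD('t) * (v $ i / sqrt (real CARD('t)) * (v $ j / sqrt (real CARD('t)))))"
        by (simp only: pconst_mult)
      also have "real CARD('t) * (v $ i / sqrt (real CARD('t)) * (v $ j / sqrt (real CARD('t)))) = v $ i * v $ j"
        using card by (simp add: field_simps)
      finally show ?thesis by (simp add: s outer_def)
    qed
    then show ?thesis by (simp add: vec_eq_iff)
  qed
  have "(\<chi> i j. \<sigma> * pconst ((B + s) $ i $ j)) = (\<chi> i j. \<sigma> * pconst (B $ i $ j)) + smult_mat \<sigma> (transpose A ** A)"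
    unfolding AA by (simp add: vec_eq_iff pconst_add distrib_left)
  also have "\<dots> \<in> nsums {smult_mat m (transpose A ** A) | m (A :: ('v, 't) pol_mat). m \<in> qmod_pol G}"
    using add.IH by (rule nsums_add_elem) (use sos_in_qmod_pol[OF assms(2)] in blast)
  finally show ?case .
qed

lemma scalar_mat_power:
  assumes "m \<in> M"
  shows "smult_mat m (mat 1) \<in> (mat_power M :: ('v, 't::finite) pol_mat set)"
proof -
  have "mat 1 = transpose (mat 1) ** (mat 1 :: ('v, 't) pol_mat)" by (simp add: transpose_mat)
  then show ?thesis unfolding mat_power_nsums using assms
    by (intro nsums_elem CollectI exI[of _ m] exI[of _ "mat 1 :: ('v, 't) pol_mat"] conjI) simp_all
qed

lemma mat_power_sum:
  "(\<And>i. i \<in> I \<Longrightarrow> f i \<in> mat_power M) \<Longrightarrow> sum f I \<in> mat_power M"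
  unfolding mat_power_nsums by (rule nsums_sum)

lemma mat_power_add:
  "A \<in> mat_power M \<Longrightarrow> B \<in> mat_power M \<Longrightarrow> A + B \<in> mat_power M"
  unfolding mat_power_nsums by (rule nsums_add)

theorem corollary4p4:
  fixes \<G> :: "('n::finite, 't::finite) pol_mat set"
    and F :: "('n, 't) pol_mat"
  assumes "finite \<G>"
    and "\<forall>A\<in>\<G>. sym_mat A \<and> even (mat_deg A)"
    and "sym_mat F" and "even (mat_deg F)"
    and "\<forall>x \<in> K_set (homog_mat ` \<G>) - {0}. pd_mat (eval_mat x (homog_mat F))"
  shows "\<exists>(G :: 'n pol set) (N :: nat).
           finite G \<and> (\<forall>g\<in>G. even (pol_deg g)) \<and> N > 0 \<and>
           smult_mat ((1 + (\<Sum>i\<in>UNIV. (X i)\<^sup>2)) ^ N) F \<in> mat_power (qmod_pol G) \<and>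
           (mat_power (qmod_pol G) :: ('n, 't) pol_mat set) \<subseteq> qmod_mat \<G>"
proof -
  obtain r where r: "mat_deg F = 2 * r" using assms(4) by (elim evenE)
  obtain \<phi> where \<phi>: "\<And>i j. form gen r (\<phi> i j) (F $ i $ j)" and sym\<phi>: "\<And>i j. \<phi> i j = \<phi> j i"
    and \<phi>_eval: "\<And>i j y x. (\<And>i j. gram y i j = x $ i * x $ j) \<Longrightarrow> \<phi> i j y = eval_mat x (homog_mat F) $ i $ j"
    using form_homog_mat[OF r assms(3)] by metis
  have symF: "F $ i $ j = F $ j $ i" for i j
    using assms(3) unfolding sym_mat_def by (metis (no_types, lifting) transpose_def vec_lambda_beta)
  define q :: "real ^ ('n option \<times> 'n option \<times> bool) \<Rightarrow> real ^ 't ^ 't" where "q y = (\<chi> i j. \<phi> i j y)" for y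
  have q: "q y $ i $ j = \<phi> i j y" for y i j by (simp add: q_def)
  have q_cont: "continuous_on A (\<lambda>y. q y $ i $ j)" for i j A
    unfolding q using \<phi> by (rule form_continuous)
  have q_eval: "q y $ i $ j = eval_mat x (homog_mat F) $ i $ j"
    if "\<And>i j. gram y i j = x $ i * x $ j" for i j x y
    unfolding q by (rule \<phi>_eval[OF that])
  obtain I c lam \<delta> k where I: "finite I" and c: "0 \<le> c" and \<delta>: "0 < \<delta>"
    and cons: "\<And>d h g. (d, h, g) \<in> I \<Longrightarrow> form gen d h g \<and> (g = 0 \<or> g \<in> full_quads \<G>)"
    and bound: "\<And>y v. (\<And>k. 0 \<le> y $ k) \<Longrightarrow> (\<Sum>k\<in>UNIV. y $ k) = 1 \<Longrightarrow>
      \<delta> * (norm v)\<^sup>2 \<le> v \<bullet> (q y *v v) - c * (\<Sum>(d, h, g)\<in>I. h y * (1 - lam * h y) ^ (2 * k)) * (norm v)\<^sup>2"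
  proof (rule finite_constraints[OF assms(2,5), of q], goal_cases)
    case 1
    show ?case by (rule q_cont)
  next
    case 2
    show ?case by (rule q_eval) (rule 2)
  next
    case (3 I c lam \<delta> k)
    show thesis by (rule that[of I c \<delta> lam k]) (rule 3; assumption)+
  qed
  \<comment> \<open>The linear form \<open>s\<close> below is 1 on the simplex and has
    \<open>T\<close> as its polynomial. Its powers therefore pad forms to a common degree without
    changing their values there.\<close>
  define T :: "'n pol" where "T = (\<Sum>k\<in>UNIV. gen k)"
  define s :: "real ^ ('n option \<times> 'n option \<times> bool) \<Rightarrow> real" where "s y = (\<Sum>k\<in>UNIV. y $ k)" for y
  have formT: "form gen m (\<lambda>y. s y ^ m) (T ^ m)" for m
    using form_power[OF form_total, of gen m] by (simp add: s_def T_def)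
  \<comment> \<open>A common degree for the form of \<open>F\<close> and all absorbed constraints;
    the extra 1 gives \<open>D > r\<close> and hence \<open>N > 0\<close>.\<close>
  define D where "D = r + (\<Sum>(d, h, g)\<in>I. d * (2 * k + 1)) + 1"
  have Dr: "D = (D - r) + r" and "D > r" by (simp_all add: D_def)
  have Dd: "D = (D - d * (2 * k + 1)) + (d + 2 * k * d)" if "(d, h, g) \<in> I" for d h g
  proof -
    have "(\<lambda>(d, h, g). d * (2 * k + 1)) (d, h, g) \<le> (\<Sum>(d, h, g)\<in>I. d * (2 * k + 1))"
      using that I by (intro member_le_sum) auto
    then have "d * (2 * k + 1) \<le> D" by (simp add: D_def)
    then show ?thesis by (simp add: algebra_simps)
  qed
  \<comment> \<open>The term \<open>h y * (1 - lam * h y) ^ (2 * k)\<close> homogenized to degree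
    \<open>D\<close>: the 1 becomes \<open>s y ^ d\<close>, and the front factor fills up the
    degree. The polynomial of this form is \<open>gt\<close>.\<close>
  define ht where "ht = (\<lambda>(d, h, g :: 'n pol) y.
      s y ^ (D - d * (2 * k + 1)) * (h y * (s y ^ d - lam * h y) ^ (2 * k)))"
  define gt :: "nat \<times> (real ^ ('n option \<times> 'n option \<times> bool) \<Rightarrow> real) \<times> 'n pol \<Rightarrow> 'n pol"
    where "gt = (\<lambda>(d, h, g). T ^ (D - d * (2 * k + 1)) * (g * (T ^ d - pconst lam * g) ^ (2 * k)))"
  have form_gt: "form gen D (ht a) (gt a)" if a: "a \<in> I" for a
  proof -
    obtain d h g where dhg: "a = (d, h, g)" by (cases a)
    have f: "form gen d h g" using cons a dhg by blast
    show ?thesis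
      unfolding dhg ht_def gt_def prod.case
      by (subst Dd[OF a[unfolded dhg]])
        (intro form_mult formT f form_power form_diff form_scale)
  qed
  \<comment> \<open>On the simplex this is the matrix estimated in \<open>bound\<close>, now with
    entries that are forms of the same degree, as Polya's theorem requires.\<close>
  define p where "p y = (\<chi> i j. s y ^ (D - r) * \<phi> i j y - (if i = j then c * (\<Sum>a\<in>I. ht a y) else 0))" for y
  define P where "P i j = T ^ (D - r) * F $ i $ j - (if i = j then pconst c * (\<Sum>a\<in>I. gt a) else 0)" for i j
  have formP: "form gen D (\<lambda>y. p y $ i $ j) (P i j)" for i j
  proof -
    have 1: "form gen D (\<lambda>y. s y ^ (D - r) * \<phi> i j y) (T ^ (D - r) * F $ i $ j)"
      by (subst Dr) (intro form_mult formT \<phi>)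
    have 2: "form gen D (\<lambda>y. if i = j then c * (\<Sum>a\<in>I. ht a y) else 0)
        (if i = j then pconst c * (\<Sum>a\<in>I. gt a) else 0)"
      by (cases "i = j") (simp_all add: form_zero form_scale form_sum form_gt)
    show ?thesis unfolding p_def P_def vec_lambda_beta by (rule form_diff[OF 1 2])
  qed
  have pos: "\<delta> * (norm v)\<^sup>2 \<le> v \<bullet> (p y *v v)"
    if "\<And>k. 0 \<le> y $ k" "(\<Sum>k\<in>UNIV. y $ k) = 1" for y v
  proof -
    have s1: "s y = 1" using that(2) by (simp add: s_def)
    define b where "b = c * (\<Sum>(d, h, g)\<in>I. h y * (1 - lam * h y) ^ (2 * k))"
    have "p y = q y - b *\<^sub>R mat 1"
      by (simp add: vec_eq_iff p_def q b_def ht_def s1 mat_def split_beta)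
    then have "v \<bullet> (p y *v v) = v \<bullet> (q y *v v) - b * (norm v)\<^sup>2"
      by (simp add: matrix_vector_mult_diff_rdistrib inner_diff_right power2_norm_eq_inner
          scaleR_matrix_vector_assoc[symmetric])
    then show ?thesis using bound[OF that] by (simp add: b_def)
  qed
  have p_sym: "p y $ i $ j = p y $ j $ i" for y i j by (simp add: p_def sym\<phi>[of i j])
  have P_sym: "P i j = P j i" for i j by (simp add: P_def symF[of i j])
  obtain M B where M: "M \<ge> D" and psd: "\<And>w. w \<in> words M \<Longrightarrow> psd_mat (B w)"
    and polya: "\<And>i j. T ^ (M - D) * P i j = (\<Sum>w\<in>words M. pconst (B w $ i $ j) * (\<Prod>l<M. gen (w l)))"
    unfolding T_def
    by (rule polya_matrix[OF formP p_sym P_sym pos \<delta>]) blast+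
  define \<theta> :: "'n pol" where "\<theta> = 1 + (\<Sum>i\<in>UNIV. (X i)\<^sup>2)"
  \<comment> \<open>Of these powers, \<open>M - D\<close> come from Polya's theorem and
    \<open>D - r\<close> from padding \<open>F\<close>.\<close>
  define N where "N = M - r"
  have N: "N > 0" "N = (M - D) + (D - r)" using M \<open>D > r\<close> by (simp_all add: N_def)
  \<comment> \<open>By \<open>sum_gen\<close>, \<open>T\<close> is CARD('n option) times \<theta>;
    this constant compensates in the \<open>N\<close>-th power.\<close>
  define \<kappa> where "\<kappa> = 1 / real (CARD('n option)) ^ N"
  have \<kappa>: "\<kappa> \<ge> 0" by (simp add: \<kappa>_def)
  have \<theta>N: "\<theta> ^ N = pconst \<kappa> * T ^ N"
  proof -
    have "pconst \<kappa> * T ^ N = pconst \<kappa> * pconst (real (CARD('n option)) ^ N) * \<theta> ^ N"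
      unfolding T_def sum_gen \<theta>_def power_mult_distrib pconst_power mult.assoc ..
    also have "pconst \<kappa> * pconst (real (CARD('n option)) ^ N) = (1 :: 'n pol)"
      by (simp add: \<kappa>_def flip: pconst_mult)
    finally show ?thesis by simp
  qed
  \<comment> \<open>The cofactor of \<open>g\<close> in the absorbed term. The even power is written
    as a square and \<open>T\<close> is a sum of squares, so all of it lies in
    \<open>sos\<close>.\<close>
  define \<sigma> where "\<sigma> = (\<lambda>(d, h :: real ^ ('n option \<times> 'n option \<times> bool) \<Rightarrow> real, g).
    pconst \<kappa> * T ^ (M - D) * pconst c * T ^ (D - d * (2 * k + 1)) * ((T ^ d - pconst lam * g) ^ k)\<^sup>2)"
  define R :: "_ \<Rightarrow> ('n, 't) pol_mat" where "R w = (\<chi> i j. (pconst \<kappa> * (\<Prod>l<M. gen (w l))) * pconst (B w $ i $ j))"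
    for w :: "nat \<Rightarrow> 'n option \<times> 'n option \<times> bool"
  \<comment> \<open>Polya's identity solved for \<open>F\<close>: each word gives a product of
    squares times a positive semidefinite matrix, and the subtracted constraints return as scalar
    matrices.\<close>
  have rep: "smult_mat (\<theta> ^ N) F = (\<Sum>w\<in>words M. R w) + (\<Sum>a\<in>I. smult_mat (\<sigma> a * snd (snd a)) (mat 1))"
  proof -
    have "\<theta> ^ N * F $ i $ j = (\<Sum>w\<in>words M. R w $ i $ j)
        + (\<Sum>a\<in>I. smult_mat (\<sigma> a * snd (snd a)) (mat 1) $ i $ j)" for i j
    proof -
      have "\<theta> ^ N * F $ i $ j = pconst \<kappa> * (T ^ (M - D) * (T ^ (D - r) * F $ i $ j))"
        unfolding \<theta>N unfolding N(2) power_add by (simp add: mult_ac)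
      also have "T ^ (D - r) * F $ i $ j = P i j + (if i = j then pconst c * (\<Sum>a\<in>I. gt a) else 0)"
        by (simp add: P_def)
      also have "pconst \<kappa> * (T ^ (M - D) * (P i j + (if i = j then pconst c * (\<Sum>a\<in>I. gt a) else 0)))
          = pconst \<kappa> * (T ^ (M - D) * P i j)
            + pconst \<kappa> * (T ^ (M - D) * (if i = j then pconst c * (\<Sum>a\<in>I. gt a) else 0))"
        by (simp only: distrib_left)
      also have "pconst \<kappa> * (T ^ (M - D) * P i j) = (\<Sum>w\<in>words M. R w $ i $ j)"
        unfolding polya by (simp add: R_def sum_distrib_left mult_ac)
      also have "pconst \<kappa> * (T ^ (M - D) * (if i = j then pconst c * (\<Sum>a\<in>I. gt a) else 0))
          = (\<Sum>a\<in>I. smult_mat (\<sigma> a * snd (snd a)) (mat 1) $ i $ j)"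
        by (cases "i = j")
          (simp_all add: mat_def gt_def \<sigma>_def sum_distrib_left split_beta power_mult mult_ac
            flip: power_mult)
      finally show ?thesis .
    qed
    then show ?thesis by (simp add: vec_eq_iff)
  qed
  \<comment> \<open>Constraints with polynomial 0 contribute zero terms to \<open>rep\<close>, so
    the polynomials kept are those in \<open>full_quads\<close>.\<close>
  define G where "G = (snd \<circ> snd) ` I \<inter> full_quads \<G>"
  have gen_sos: "gen k \<in> sos" for k :: "'n option \<times> 'n option \<times> bool"
    unfolding gen_def by (rule sos_square)
  have T_sos: "T \<in> sos" unfolding T_def by (intro sos_sum gen_sos)
  have prod_sos: "(\<Prod>l<m. gen (w l)) \<in> sos" for m :: nat and w :: "nat \<Rightarrow> 'n option \<times> 'n option \<times> bool"
    by (induction m) (simp_all add: sos_one sos_mult gen_sos)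
  have "smult_mat (\<theta> ^ N) F \<in> mat_power (qmod_pol G)"
    unfolding rep
  proof (intro mat_power_add mat_power_sum)
    show "R w \<in> mat_power (qmod_pol G)" if "w \<in> words M" for w
      unfolding R_def by (intro psd_mat_power psd that sos_mult pconst_sos \<kappa> prod_sos)
    fix a assume a: "a \<in> I"
    obtain d h g where dhg: "a = (d, h, g)" by (cases a)
    have \<sigma>: "\<sigma> a \<in> sos"
      unfolding \<sigma>_def dhg prod.case
      by (intro sos_mult sos_square sos_power pconst_sos \<kappa> c T_sos)
    have "g = 0 \<or> g \<in> G" using cons a dhg unfolding G_def by force
    then have "\<sigma> a * g \<in> qmod_pol G"
      using sos_mult_in_qmod_pol[OF \<sigma>] sos_in_qmod_pol[OF sos_square[of 0]] by auto
    then show "smult_mat (\<sigma> a * snd (snd a)) (mat 1) \<in> mat_power (qmod_pol G)"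
      by (simp add: dhg scalar_mat_power)
  qed
  moreover have "finite G" using I by (simp add: G_def)
  moreover have "\<forall>g\<in>G. even (pol_deg g)"
    using assms(2) unfolding G_def full_quads_def by auto
  moreover have "(mat_power (qmod_pol G) :: ('n, 't) pol_mat set) \<subseteq> qmod_mat \<G>"
    by (rule mat_power_subset_qmod_mat) (auto simp: G_def full_quads_def)
  ultimately show ?thesis using N(1) unfolding \<theta>_def by blast
qed

end
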